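(* Let $\mathbb{H}$ be an elementary abelian $2$-hypergroup, the constrained direct product of $\langle q_1\rangle,\dots,\langle q_p\rangle$ with $q_1,\dots,q_p$ involutions of $\mathbb{H}$, and let $p^\sharp$ be the number of thick elements of $\mathbb{H}$ contained in $\{q_1,\dots,q_p\}$. Let $\mathbb{G}$ be a closed subset of $\mathbb{H}$. Then $$\mathrm{Aut}(\mathbb{G})\cong\mathbb{S}_{\mathrm{s}(\mathbb{G})}\times\mathbb{GL}(\mathrm{r}_2(\mathbb{G}),2)\quad\text{and}\quad\mathrm{Aut}(\mathbb{H})\cong\mathbb{S}_{p^\sharp}\times\mathbb{GL}(p-p^\sharp,2).$$
   Context: A hypergroup is a nonempty set $\mathbb{H}$ with a hypermultiplication $(a,b)\mapsto ab\subseteq\mathbb{H}$ and a map $a\mapsto a^*$ from $\mathbb{H}$ to $\mathbb{H}$ such that, writing $\mathbb{F}\mathbb{G}=\bigcup_{b\in\mathbb{F},c\in\mathbb{G}}bc$ for $\mathbb{F},\mathbb{G}\subseteq\mathbb{H}$ and $a\mathbb{G}=\{a\}\mathbb{G}$, $\mathbb{G}a=\mathbb{G}\{a\}$: (1) $(ab)c=a(bc)$ for all $a,b,c$; (2) there is a unique $e\in\mathbb{H}$ with $ea=\{a\}=ae$ for all $a$; (3) for all $a,b,c$ the conditions $a\in bc$, $b\in ac^*$, $c\in b^*a$ are pairwise equivalent. A nonempty $\mathbb{G}\subseteq\mathbb{H}$ is a closed subset of $\mathbb{H}$ if $\mathbb{G}^*\mathbb{G}\subseteq\mathbb{G}$,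 where $\mathbb{G}^*=\{a^*:a\in\mathbb{G}\}$. $\langle a\rangle$ is the intersection of all closed subsets of $\mathbb{H}$ containing $a$. An element $a$ is thin if $a^*a=\{e\}$ and thick otherwise. A closed subset is thin if all its elements are thin. A closed subset $\mathbb{F}$ of $\mathbb{H}$ is normal in $\mathbb{H}$ if $\mathbb{F}a=a\mathbb{F}$ for all $a\in\mathbb{H}$. An involution is an element $a\neq e$ such that $\{e,a\}$ is closed. If $a,b$ are thin, then $ab$ is a singleton $\{c\}$ with $c$ thin; for a thin closed subset $\mathbb{G}$, $\mathbb{G}^\gamma=\{\{a\}:a\in\mathbb{G}\}$ is a group under $\{a\}\bullet\{b\}=ab$ with identity $\{e\}$, and the $2$-rank of a finite thin closed subset $\mathbb{G}$ is the $2$-rank of $\mathbb{G}^\gamma$. For a finite closed subset $\mathbb{G}$, $\mathrm{r}_2(\mathbb{G})$ is the largest $2$-rank of a thin closed subset of $\mathbb{H}$ contained in $\mathbb{G}$. Elementary abelian $2$-hypergroups: $\mathbb{H}$ is the direct product of normal closed subsets $\mathbb{G}_1,\dots,\mathbb{G}_p$ ($p\geq 1$) if, for each $i$, $\mathbb{H}=\mathbb{G}_i\widehat{\mathbb{G}_i}$ and $\mathbb{G}_i\cap\widehat{\mathbb{G}_i}=\{e\}$, where $\widehat{\mathbb{G}_i}=\prod_{j\neq i}\mathbb{G}_j$ (and $\widehat{\mathbb{G}_1}=\{e\}$ if $p=1$). Then for every $a\in\mathbb{H}$ there are unique $r_i\in\mathbb{G}_i$ ($1\le i\le p$) with $a\in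 r_1r_2\cdots r_p$; the set $\{r_1,\dots,r_p\}\setminus\{e\}$ is the support of $a$. The direct product is constrained if $r_1r_2\cdots r_p=\{a\}$ for every $a\in\mathbb{H}$. $\mathbb{H}$ is an elementary abelian $2$-hypergroup if it is the constrained direct product of closed subsets $\langle q_1\rangle,\dots,\langle q_p\rangle$ with $q_1,\dots,q_p$ involutions of $\mathbb{H}$ (so $\langle q_i\rangle=\{e,q_i\}$); supports are taken with respect to this fixed decomposition. For $a\in\mathbb{H}$, $\mathrm{s}(a)$ is the number of thick elements in the support of $a$; for a closed subset $\mathbb{G}$, $\mathrm{s}(\mathbb{G})=\max\{\mathrm{s}(a):a\in\mathbb{G}\}$. $\mathrm{Aut}(\mathbb{G})$ is the group, under composition, of all bijections $\alpha:\mathbb{G}\to\mathbb{G}$ with $e^\alpha=e$ and $(ab)^\alpha=a^\alpha b^\alpha$ for all $a,b\in\mathbb{G}$, where $(ab)^\alpha$ is the image of the set $ab$. $\mathbb{S}_m$ is the symmetric group on $\{1,\dots,m\}$ and $\mathbb{GL}(m,2)$ is the general linear group of degree $m$ over the field of $2$ elements; $\mathbb{S}_0$ and $\mathbb{GL}(0,2)$ are trivial groups. *)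

theory Defs
  imports
    "HOL-Algebra.Bij"
    "HOL-Algebra.Sym_Groups"
    "HOL-Library.Z2"
    "Jordan_Normal_Form.Matrix"
begin

section \<open>Hypergroups\<close>

record 'a hyperstruct = "'a partial_object" +
  hmult :: "'a \<Rightarrow> 'a \<Rightarrow> 'a set"
  hstar :: "'a \<Rightarrow> 'a"

definition hset_mult :: "('a, 'b) hyperstruct_scheme \<Rightarrow> 'a set \<Rightarrow> 'a set \<Rightarrow> 'a set" where
  "hset_mult H F G = (\<Union>b\<in>F. \<Union>c\<in>G. hmult H b c)"

definition is_neutral :: "('a, 'b) hyperstruct_scheme \<Rightarrow> 'a \<Rightarrow> bool" where
  "is_neutral H e \<longleftrightarrow>
     e \<in> carrier H \<and> (\<forall>a\<in>carrier H. hmult H e a = {a} \<and> hmult H a e = {a})"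

definition hone :: "('a, 'b) hyperstruct_scheme \<Rightarrow> 'a" where
  "hone H = (THE e. is_neutral H e)"

locale hypergroup =
  fixes H :: "('a, 'b) hyperstruct_scheme" (structure)
  assumes carrier_nonempty: "carrier H \<noteq> {}"
    and hmult_closed: "\<lbrakk>a \<in> carrier H; b \<in> carrier H\<rbrakk> \<Longrightarrow> hmult H a b \<subseteq> carrier H"
    and hstar_closed: "a \<in> carrier H \<Longrightarrow> hstar H a \<in> carrier H"
    and hmult_assoc: "\<lbrakk>a \<in> carrier H; b \<in> carrier H; c \<in> carrier H\<rbrakk> \<Longrightarrow>
           hset_mult H (hmult H a b) {c} = hset_mult H {a} (hmult H b c)"
    and ex1_neutral: "\<exists>!e. is_neutral H e"
    and exchange1: "\<lbrakk>a \<in> carrier H; b \<in> carrier H; c \<in> carrier H\<rbrakk> \<Longrightarrow>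
           a \<in> hmult H b c \<longleftrightarrow> b \<in> hmult H a (hstar H c)"
    and exchange2: "\<lbrakk>a \<in> carrier H; b \<in> carrier H; c \<in> carrier H\<rbrakk> \<Longrightarrow>
           a \<in> hmult H b c \<longleftrightarrow> c \<in> hmult H (hstar H b) a"

definition closed_subset :: "('a, 'b) hyperstruct_scheme \<Rightarrow> 'a set \<Rightarrow> bool" where
  "closed_subset H G \<longleftrightarrow>
     G \<noteq> {} \<and> G \<subseteq> carrier H \<and> hset_mult H (hstar H ` G) G \<subseteq> G"

definition hgen :: "('a, 'b) hyperstruct_scheme \<Rightarrow> 'a \<Rightarrow> 'a set" where
  "hgen H a = \<Inter>{G. closed_subset H G \<and> a \<in> G}"

definition thin :: "('a, 'b) hyperstruct_scheme \<Rightarrow> 'a \<Rightarrow> bool" where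
  "thin H a \<longleftrightarrow> a \<in> carrier H \<and> hmult H (hstar H a) a = {hone H}"

definition thick :: "('a, 'b) hyperstruct_scheme \<Rightarrow> 'a \<Rightarrow> bool" where
  "thick H a \<longleftrightarrow> a \<in> carrier H \<and> \<not> thin H a"

definition thin_closed_subset :: "('a, 'b) hyperstruct_scheme \<Rightarrow> 'a set \<Rightarrow> bool" where
  "thin_closed_subset H G \<longleftrightarrow> closed_subset H G \<and> (\<forall>a\<in>G. thin H a)"

definition normal_closed_subset :: "('a, 'b) hyperstruct_scheme \<Rightarrow> 'a set \<Rightarrow> bool" where
  "normal_closed_subset H F \<longleftrightarrow>
     closed_subset H F \<and> (\<forall>a\<in>carrier H. hset_mult H F {a} = hset_mult H {a} F)"

definition involution :: "('a, 'b) hyperstruct_scheme \<Rightarrow> 'a \<Rightarrow> bool" where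
  "involution H a \<longleftrightarrow> a \<in> carrier H \<and> a \<noteq> hone H \<and> closed_subset H {hone H, a}"


section \<open>The 2-rank\<close>

text \<open>The group of singletons of a thin closed subset. On singletons \<^const>\<open>hset_mult\<close> is the
  hypermultiplication of the underlying elements.\<close>

definition thin_group :: "('a, 'b) hyperstruct_scheme \<Rightarrow> 'a set \<Rightarrow> 'a set monoid" where
  "thin_group H G = \<lparr>carrier = (\<lambda>a. {a}) ` G, monoid.mult = hset_mult H, one = {hone H}\<rparr>"

text \<open>The 2-rank of a finite group is the largest rank of an elementary abelian 2-subgroup.\<close>

definition elementary_abelian_2_subgroup :: "('c, 'd) monoid_scheme \<Rightarrow> 'c set \<Rightarrow> bool" where
  "elementary_abelian_2_subgroup K E \<longleftrightarrow>
     subgroup E K \<and> comm_group (K\<lparr>carrier := E\<rparr>) \<and> (\<forall>x\<in>E. x \<otimes>\<^bsub>K\<^esub> x = \<one>\<^bsub>K\<^esub>)"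

definition two_rank :: "('c, 'd) monoid_scheme \<Rightarrow> nat" where
  "two_rank K = Max {n. \<exists>E. elementary_abelian_2_subgroup K E \<and> card E = 2 ^ n}"

definition r2 :: "('a, 'b) hyperstruct_scheme \<Rightarrow> 'a set \<Rightarrow> nat" where
  "r2 H G = Max {two_rank (thin_group H F) |F. thin_closed_subset H F \<and> F \<subseteq> G}"


section \<open>Direct products and elementary abelian 2-hypergroups\<close>

definition hprod :: "('a, 'b) hyperstruct_scheme \<Rightarrow> 'a set list \<Rightarrow> 'a set" where
  "hprod H Fs = foldr (hset_mult H) Fs {hone H}"

definition hprod_except ::
    "('a, 'b) hyperstruct_scheme \<Rightarrow> (nat \<Rightarrow> 'a set) \<Rightarrow> nat \<Rightarrow> nat \<Rightarrow> 'a set" where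
  "hprod_except H G p i = hprod H (map G (filter (\<lambda>j. j \<noteq> i) [1..<Suc p]))"

definition direct_product ::
    "('a, 'b) hyperstruct_scheme \<Rightarrow> (nat \<Rightarrow> 'a set) \<Rightarrow> nat \<Rightarrow> bool" where
  "direct_product H G p \<longleftrightarrow>
     p \<ge> 1 \<and>
     (\<forall>i\<in>{1..p}. normal_closed_subset H (G i)) \<and>
     (\<forall>i\<in>{1..p}. carrier H = hset_mult H (G i) (hprod_except H G p i) \<and>
                  G i \<inter> hprod_except H G p i = {hone H})"

definition hprod_elems :: "('a, 'b) hyperstruct_scheme \<Rightarrow> (nat \<Rightarrow> 'a) \<Rightarrow> nat \<Rightarrow> 'a set" where
  "hprod_elems H r p = hprod H (map (\<lambda>i. {r i}) [1..<Suc p])"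

text \<open>The components of an element are taken as an extensional function on \<open>{1..p}\<close>, so that they
  are unique as a function on \<^typ>\<open>nat\<close>.\<close>

definition is_decomposition ::
    "('a, 'b) hyperstruct_scheme \<Rightarrow> (nat \<Rightarrow> 'a set) \<Rightarrow> nat \<Rightarrow> 'a \<Rightarrow> (nat \<Rightarrow> 'a) \<Rightarrow> bool" where
  "is_decomposition H G p a r \<longleftrightarrow> r \<in> (\<Pi>\<^sub>E i\<in>{1..p}. G i) \<and> a \<in> hprod_elems H r p"

definition constrained_direct_product ::
    "('a, 'b) hyperstruct_scheme \<Rightarrow> (nat \<Rightarrow> 'a set) \<Rightarrow> nat \<Rightarrow> bool" where
  "constrained_direct_product H G p \<longleftrightarrow>
     direct_product H G p \<and>
     (\<forall>a\<in>carrier H. \<forall>r. is_decomposition H G p a r \<longrightarrow> hprod_elems H r p = {a})"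

definition supp ::
    "('a, 'b) hyperstruct_scheme \<Rightarrow> (nat \<Rightarrow> 'a set) \<Rightarrow> nat \<Rightarrow> 'a \<Rightarrow> 'a set" where
  "supp H G p a = (THE r. is_decomposition H G p a r) ` {1..p} - {hone H}"

definition elementary_abelian_2_hypergroup ::
    "('a, 'b) hyperstruct_scheme \<Rightarrow> (nat \<Rightarrow> 'a) \<Rightarrow> nat \<Rightarrow> bool" where
  "elementary_abelian_2_hypergroup H q p \<longleftrightarrow>
     hypergroup H \<and>
     (\<forall>i\<in>{1..p}. involution H (q i)) \<and>
     constrained_direct_product H (\<lambda>i. hgen H (q i)) p"

definition s_elem :: "('a, 'b) hyperstruct_scheme \<Rightarrow> (nat \<Rightarrow> 'a) \<Rightarrow> nat \<Rightarrow> 'a \<Rightarrow> nat" where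
  "s_elem H q p a = card {x \<in> supp H (\<lambda>i. hgen H (q i)) p a. thick H x}"

definition s_set :: "('a, 'b) hyperstruct_scheme \<Rightarrow> (nat \<Rightarrow> 'a) \<Rightarrow> nat \<Rightarrow> 'a set \<Rightarrow> nat" where
  "s_set H q p G = Max (s_elem H q p ` G)"

definition p_sharp :: "('a, 'b) hyperstruct_scheme \<Rightarrow> (nat \<Rightarrow> 'a) \<Rightarrow> nat \<Rightarrow> nat" where
  "p_sharp H q p = card {x \<in> q ` {1..p}. thick H x}"


section \<open>Automorphism groups and general linear groups\<close>

definition hAut :: "('a, 'b) hyperstruct_scheme \<Rightarrow> 'a set \<Rightarrow> ('a \<Rightarrow> 'a) monoid" where
  "hAut H G = BijGroup G
     \<lparr>carrier := {f \<in> Bij G. f (hone H) = hone H \<and>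
        (\<forall>a\<in>G. \<forall>b\<in>G. f ` hmult H a b = hmult H (f a) (f b))}\<rparr>"

text \<open>\<^typ>\<open>bit\<close> is the field with two elements.\<close>

definition GL2 :: "nat \<Rightarrow> bit mat monoid" where
  "GL2 m = units_of (ring_mat TYPE(bit) m ())"

end

theory Submission
  imports Defs
begin

text \<open>In \<open>H\<close> distinct \<open>q\<^sub>i\<close> commute and \<open>q\<^sub>i q\<^sub>i\<close> is \<open>{e}\<close> or \<open>{e, q\<^sub>i}\<close>, so \<open>H\<close> is the set of all
  \<open>X \<subseteq> {1..p}\<close>, where \<open>XY\<close> consists of the sets obtained from the symmetric difference of \<open>X\<close> and
  \<open>Y\<close> by adding arbitrary thick indices from \<open>X \<inter> Y\<close>. Hence a closed subset has the form
  \<open>Pow S \<times> V\<close> with \<open>S\<close> the thick indices that occur and \<open>V\<close> an \<open>\<FF>\<^sub>2\<close>-vector space of thin elements. An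
  automorphism preserves \<open>V\<close>, on which it is linear, and maps idempotents \<open>x \<in> xx\<close> to idempotents;
  these are the subsets \<open>A\<close> of \<open>S\<close>, and since \<open>AA = Pow A\<close>, it acts on them by a permutation of
  \<open>S\<close>. Conversely, every pair of a permutation and an invertible matrix gives an automorphism.\<close>

section \<open>Products of sets in a hypergroup\<close>

text \<open>The axioms speak of products of sets, so the coordinates have to be earned. Index sets
  label the elements injectively because of the trivial intersections: involutions are self-inverse,
  so e in q_i x forces x = q_i, which no product of the other factors contains. The constraint makes
  each product of components a single element. The two parts of Pow S x V are recognised by squares:
  the square of (A, v) is Pow A x {0}, so it equals {e} exactly for A empty and contains (A, v)
  exactly for v = 0, and automorphisms respect both conditions. They are determined by the two parts
  since (A, v) is the only member of (A, 0)({}, v). For general G the space V has no distinguished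
  basis, so its dimension m first arises from an induction and is identified afterwards: with
  r_2(G), because the thin elements of G are those of V, and for G = H with the number of thin q_i,
  by counting |H| = 2^p.\<close>

lemma hset_mult_mono: "F \<subseteq> F' \<Longrightarrow> K \<subseteq> K' \<Longrightarrow> hset_mult H F K \<subseteq> hset_mult H F' K'"
  by (auto simp: hset_mult_def)

lemma hset_mult_singletons [simp]: "hset_mult H {a} {b} = hmult H a b"
  by (simp add: hset_mult_def)

lemma hprod_Nil [simp]: "hprod H [] = {hone H}"
  and hprod_Cons [simp]: "hprod H (F # Fs) = hset_mult H F (hprod H Fs)"
  by (simp_all add: hprod_def)

lemma hprod_mono: "(\<And>i. i \<in> set xs \<Longrightarrow> F i \<subseteq> F' i) \<Longrightarrow> hprod H (map F xs) \<subseteq> hprod H (map F' xs)"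
  by (induction xs) (simp_all add: hset_mult_mono)

text \<open>Members of a product of sets come from selections, one per index. Distinctness matters
  because a selection is a function of the index: a repeated index would tie two independent choices
  together.\<close>

lemma mem_hprod_map_iff:
  assumes "distinct xs"
  shows "x \<in> hprod H (map F xs) \<longleftrightarrow>
    (\<exists>r. (\<forall>i\<in>set xs. r i \<in> F i) \<and> x \<in> hprod H (map (\<lambda>i. {r i}) xs))"
  using assms
proof (induction xs arbitrary: x)
  case (Cons j ys)
  show ?case
  proof
    assume "x \<in> hprod H (map F (j # ys))"
    then obtain a y where a: "a \<in> F j" and y: "y \<in> hprod H (map F ys)" and x: "x \<in> hmult H a y"
      by (auto simp: hset_mult_def)
    from Cons y obtain r where r: "\<forall>i\<in>set ys. r i \<in> F i" "y \<in> hprod H (map (\<lambda>i. {r i}) ys)"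
      by auto
    have *: "map (\<lambda>i. {(r(j := a)) i}) ys = map (\<lambda>i. {r i}) ys"
      using Cons.prems by auto
    have "x \<in> hprod H (map (\<lambda>i. {(r(j := a)) i}) (j # ys))"
      unfolding list.map hprod_Cons * using x r(2) by (auto simp: hset_mult_def)
    then show "\<exists>r. (\<forall>i\<in>set (j # ys). r i \<in> F i) \<and> x \<in> hprod H (map (\<lambda>i. {r i}) (j # ys))"
      using a r(1) by (intro exI[of _ "r(j := a)"]) auto
  next
    assume "\<exists>r. (\<forall>i\<in>set (j # ys). r i \<in> F i) \<and> x \<in> hprod H (map (\<lambda>i. {r i}) (j # ys))"
    then obtain r where "\<forall>i\<in>set (j # ys). r i \<in> F i" "x \<in> hprod H (map (\<lambda>i. {r i}) (j # ys))"
      by blast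
    moreover have "hprod H (map (\<lambda>i. {r i}) (j # ys)) \<subseteq> hprod H (map F (j # ys))"
      by (rule hprod_mono) (use calculation(1) in auto)
    ultimately show "x \<in> hprod H (map F (j # ys))"
      by blast
  qed
qed simp

context hypergroup
begin

section \<open>Neutral element, inverses and products of sets\<close>

lemma neutral_hone: "is_neutral H (hone H)"
  unfolding hone_def by (rule theI'[OF ex1_neutral])

lemma hone_closed [simp]: "hone H \<in> carrier H"
  and hmult_hone_left [simp]: "a \<in> carrier H \<Longrightarrow> hmult H (hone H) a = {a}"
  and hmult_hone_right [simp]: "a \<in> carrier H \<Longrightarrow> hmult H a (hone H) = {a}"
  using neutral_hone by (auto simp: is_neutral_def)

lemma hone_in_hstar_hmult: "a \<in> carrier H \<Longrightarrow> hone H \<in> hmult H (hstar H a) a"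
  using exchange2[of a a "hone H"] by simp

lemma hstar_eqI:
  assumes "a \<in> carrier H" "b \<in> carrier H" "hone H \<in> hmult H a b"
  shows "hstar H a = b"
  using exchange2[of "hone H" a b] assms hstar_closed[of a] by simp

lemma hset_mult_closed:
  "F \<subseteq> carrier H \<Longrightarrow> K \<subseteq> carrier H \<Longrightarrow> hset_mult H F K \<subseteq> carrier H"
  unfolding hset_mult_def using hmult_closed by blast

lemma hset_mult_hone_left: "F \<subseteq> carrier H \<Longrightarrow> hset_mult H {hone H} F = F"
  by (auto simp: hset_mult_def subset_eq)

lemma hset_mult_hone_right: "F \<subseteq> carrier H \<Longrightarrow> hset_mult H F {hone H} = F"
  by (auto simp: hset_mult_def subset_eq)

lemma hset_mult_assoc:
  assumes "F \<subseteq> carrier H" "K \<subseteq> carrier H" "L \<subseteq> carrier H"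
  shows "hset_mult H (hset_mult H F K) L = hset_mult H F (hset_mult H K L)"
proof -
  have "hset_mult H (hset_mult H F K) L = (\<Union>a\<in>F. \<Union>b\<in>K. \<Union>c\<in>L. hset_mult H (hmult H a b) {c})"
    by (auto simp: hset_mult_def)
  also have "\<dots> = (\<Union>a\<in>F. \<Union>b\<in>K. \<Union>c\<in>L. hset_mult H {a} (hmult H b c))"
    using assms by (intro SUP_cong refl hmult_assoc) auto
  also have "\<dots> = hset_mult H F (hset_mult H K L)"
    by (auto simp: hset_mult_def)
  finally show ?thesis .
qed

text \<open>If ab were empty, so would be (a^* a) b = a^* (ab); but a^* a contains e, and eb =
  {b}.\<close>

lemma hmult_nonempty:
  assumes "a \<in> carrier H" "b \<in> carrier H"
  shows "hmult H a b \<noteq> {}"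
proof
  assume "hmult H a b = {}"
  then have "hset_mult H (hmult H (hstar H a) a) {b} = {}"
    using hmult_assoc[of "hstar H a" a b] assms hstar_closed by (simp add: hset_mult_def)
  then show False
    using hone_in_hstar_hmult[OF assms(1)] assms(2) by (auto simp: hset_mult_def)
qed

lemma hset_mult_nonempty:
  assumes "F \<subseteq> carrier H" "K \<subseteq> carrier H" "F \<noteq> {}" "K \<noteq> {}"
  shows "hset_mult H F K \<noteq> {}"
proof -
  obtain a b where ab: "a \<in> F" "b \<in> K"
    using assms by auto
  then have "hmult H a b \<subseteq> hset_mult H F K"
    by (auto simp: hset_mult_def)
  moreover have "hmult H a b \<noteq> {}"
    using ab assms by (intro hmult_nonempty) auto
  ultimately show ?thesis
    by auto
qed

lemma hprod_closed: "(\<And>F. F \<in> set Fs \<Longrightarrow> F \<subseteq> carrier H) \<Longrightarrow> hprod H Fs \<subseteq> carrier H"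
  by (induction Fs) (simp_all add: hset_mult_closed)

lemma hprod_map_closed:
  "(\<And>i. i \<in> set xs \<Longrightarrow> F i \<subseteq> carrier H) \<Longrightarrow> hprod H (map F xs) \<subseteq> carrier H"
  by (induction xs) (simp_all add: hset_mult_closed)

lemma hprod_nonempty:
  "(\<And>F. F \<in> set Fs \<Longrightarrow> F \<subseteq> carrier H) \<Longrightarrow> (\<And>F. F \<in> set Fs \<Longrightarrow> F \<noteq> {}) \<Longrightarrow> hprod H Fs \<noteq> {}"
  by (induction Fs) (simp_all add: hset_mult_nonempty hprod_closed)

lemma hset_mult_hprod_commute:
  assumes "F \<subseteq> carrier H" "\<And>i. i \<in> set xs \<Longrightarrow> K i \<subseteq> carrier H"
    and "\<And>i. i \<in> set xs \<Longrightarrow> hset_mult H F (K i) = hset_mult H (K i) F"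
  shows "hset_mult H F (hprod H (map K xs)) = hset_mult H (hprod H (map K xs)) F"
  using assms(2,3)
proof (induction xs)
  case Nil
  then show ?case
    using assms(1) by (simp add: hset_mult_hone_left hset_mult_hone_right)
next
  case (Cons i xs)
  let ?P = "hprod H (map K xs)"
  have c: "K i \<subseteq> carrier H" "?P \<subseteq> carrier H" "F \<subseteq> carrier H"
    using Cons.prems(1) assms(1) by (simp_all add: hprod_map_closed)
  have IH: "hset_mult H F ?P = hset_mult H ?P F"
    using Cons.prems by (intro Cons.IH) simp_all
  have "hset_mult H F (hset_mult H (K i) ?P) = hset_mult H (hset_mult H F (K i)) ?P"
    using c by (simp add: hset_mult_assoc)
  also have "\<dots> = hset_mult H (hset_mult H (K i) F) ?P"
    using Cons.prems(2)[of i] by simp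
  also have "\<dots> = hset_mult H (K i) (hset_mult H ?P F)"
    using c by (simp add: hset_mult_assoc IH)
  also have "\<dots> = hset_mult H (hset_mult H (K i) ?P) F"
    using c by (simp add: hset_mult_assoc)
  finally show ?case
    by simp
qed

text \<open>Each \<open>K i\<close> is moved left past the later \<open>F j\<close>, so only sets at
  different indices have to commute.\<close>

lemma hprod_mult:
  assumes "distinct xs" "\<And>i. i \<in> set xs \<Longrightarrow> F i \<subseteq> carrier H" "\<And>i. i \<in> set xs \<Longrightarrow> K i \<subseteq> carrier H"
    and "\<And>i j. i \<in> set xs \<Longrightarrow> j \<in> set xs \<Longrightarrow> i \<noteq> j \<Longrightarrow> hset_mult H (K i) (F j) = hset_mult H (F j) (K i)"
  shows "hset_mult H (hprod H (map F xs)) (hprod H (map K xs)) =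
    hprod H (map (\<lambda>i. hset_mult H (F i) (K i)) xs)"
  using assms
proof (induction xs)
  case Nil
  then show ?case
    by simp
next
  case (Cons i ys)
  let ?F = "hprod H (map F ys)" and ?K = "hprod H (map K ys)"
  have c: "F i \<subseteq> carrier H" "K i \<subseteq> carrier H" "?F \<subseteq> carrier H" "?K \<subseteq> carrier H"
    using Cons.prems(2,3) by (simp_all add: hprod_map_closed)
  have comm: "hset_mult H (K i) ?F = hset_mult H ?F (K i)"
  proof (rule hset_mult_hprod_commute)
    fix j assume "j \<in> set ys"
    then have "i \<noteq> j"
      using Cons.prems(1) by auto
    then show "hset_mult H (K i) (F j) = hset_mult H (F j) (K i)"
      using Cons.prems(4)[of i j] \<open>j \<in> set ys\<close> by simp
  qed (use c Cons.prems(2) in simp_all)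
  have "hset_mult H (hset_mult H (F i) ?F) (hset_mult H (K i) ?K) =
      hset_mult H (F i) (hset_mult H (hset_mult H ?F (K i)) ?K)"
    using c by (simp add: hset_mult_assoc hset_mult_closed)
  also have "\<dots> = hset_mult H (F i) (hset_mult H (hset_mult H (K i) ?F) ?K)"
    by (simp only: comm)
  also have "\<dots> = hset_mult H (hset_mult H (F i) (K i)) (hset_mult H ?F ?K)"
    using c by (simp add: hset_mult_assoc hset_mult_closed)
  also have "hset_mult H ?F ?K = hprod H (map (\<lambda>i. hset_mult H (F i) (K i)) ys)"
    using Cons.prems by (intro Cons.IH) simp_all
  finally show ?case
    by simp
qed

text \<open>With one factor in front, a product over all indices takes the shape to which the
  conditions on \<open>hprod_except\<close> refer.\<close>

lemma hprod_extract:
  assumes "distinct xs" "i \<in> set xs" "\<And>j. j \<in> set xs \<Longrightarrow> F j \<subseteq> carrier H"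
    and "\<And>j. j \<in> set xs \<Longrightarrow> j \<noteq> i \<Longrightarrow> hset_mult H (F i) (F j) = hset_mult H (F j) (F i)"
  shows "hprod H (map F xs) = hset_mult H (F i) (hprod H (map F (filter (\<lambda>j. j \<noteq> i) xs)))"
  using assms
proof (induction xs)
  case (Cons j ys)
  show ?case
  proof (cases "j = i")
    case True
    then have "filter (\<lambda>j. j \<noteq> i) ys = ys"
      using Cons.prems(1) by (auto simp: filter_id_conv)
    with True show ?thesis
      by simp
  next
    case False
    let ?P = "hprod H (map F (filter (\<lambda>j. j \<noteq> i) ys))"
    have c: "F i \<subseteq> carrier H" "F j \<subseteq> carrier H"
      using Cons.prems(2,3) by simp_all
    have P: "?P \<subseteq> carrier H"
      by (rule hprod_map_closed) (use Cons.prems(3) in simp)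
    have "hprod H (map F ys) = hset_mult H (F i) ?P"
      using Cons.prems False by (intro Cons.IH) simp_all
    then have "hprod H (map F (j # ys)) = hset_mult H (hset_mult H (F j) (F i)) ?P"
      using c P by (simp add: hset_mult_assoc)
    also have "\<dots> = hset_mult H (F i) (hset_mult H (F j) ?P)"
      using c P False Cons.prems(4)[of j] by (simp flip: hset_mult_assoc)
    finally show ?thesis
      using False by simp
  qed
qed simp

section \<open>Closed subsets and involutions\<close>

lemma closed_subset_hone:
  assumes "closed_subset H F"
  shows "hone H \<in> F"
proof -
  obtain a where a: "a \<in> F"
    using assms by (auto simp: closed_subset_def)
  then have "hone H \<in> hset_mult H (hstar H ` F) F"
    using hone_in_hstar_hmult[of a] assms by (auto simp: hset_mult_def closed_subset_def)
  then show ?thesis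
    using assms by (auto simp: closed_subset_def)
qed

lemma closed_subset_carrier: "closed_subset H (carrier H)"
proof -
  have "hstar H ` carrier H \<subseteq> carrier H"
    using hstar_closed by blast
  then show ?thesis
    using carrier_nonempty hset_mult_closed by (simp add: closed_subset_def)
qed

lemma hgen_involution:
  assumes "involution H a"
  shows "hgen H a = {hone H, a}"
  using assms closed_subset_hone by (auto simp: hgen_def involution_def)

text \<open>Closedness of {e, a} puts a^*, the only member of a^* e, into it; and a^* = e is
  impossible, since e lies in a^* a while ea = {a}.\<close>

lemma involution_hmult_self:
  assumes "involution H a"
  shows "hstar H a = a" "hmult H a a \<subseteq> {hone H, a}" "hone H \<in> hmult H a a"
proof -
  have a: "a \<in> carrier H" "a \<noteq> hone H"
    and sub: "hset_mult H (hstar H ` {hone H, a}) {hone H, a} \<subseteq> {hone H, a}"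
    using assms by (auto simp: involution_def closed_subset_def)
  have e: "hstar H (hone H) = hone H"
    by (rule hstar_eqI) auto
  have "hstar H a \<in> {hone H, a}"
    using sub hstar_closed[OF a(1)] by (auto simp: hset_mult_def)
  moreover have "hstar H a \<noteq> hone H"
    using hone_in_hstar_hmult[OF a(1)] a by auto
  ultimately show *: "hstar H a = a"
    by auto
  show "hmult H a a \<subseteq> {hone H, a}"
    using sub * by (auto simp: hset_mult_def)
  show "hone H \<in> hmult H a a"
    using hone_in_hstar_hmult[OF a(1)] * by simp
qed

end

section \<open>Coordinates in an elementary abelian 2-hypergroup\<close>

locale elementary_abelian_2 = hypergroup H for H :: "('a, 'b) hyperstruct_scheme" (structure) +
  fixes q :: "nat \<Rightarrow> 'a" and p :: nat
  assumes invol: "i \<in> {1..p} \<Longrightarrow> involution H (q i)"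
    and constrained: "constrained_direct_product H (\<lambda>i. hgen H (q i)) p"
begin

definition thick_idx :: "nat set" where
  "thick_idx = {i \<in> {1..p}. thick H (q i)}"

definition coord :: "nat set \<Rightarrow> nat \<Rightarrow> 'a" where
  "coord X i = (if i \<in> X then q i else hone H)"

text \<open>The product of the \<open>q i\<close> with \<open>i \<in> X\<close>, in the order of the
  indices and with \<open>hone H\<close> at all other places. The use of \<open>the_elem\<close> is
  justified by \<open>hprod_coord\<close>.\<close>

definition elt :: "nat set \<Rightarrow> 'a" where
  "elt X = the_elem (hprod_elems H (coord X) p)"

abbreviation factors :: "nat \<Rightarrow> 'a set" where
  "factors \<equiv> \<lambda>i. hgen H (q i)"

lemma product: "direct_product H factors p"
  using constrained by (simp add: constrained_direct_product_def)

lemma p_pos: "1 \<le> p"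
  using product by (simp add: direct_product_def)

lemma factors_eq: "i \<in> {1..p} \<Longrightarrow> factors i = {hone H, q i}"
  using invol by (simp add: hgen_involution)

lemma q_closed: "i \<in> {1..p} \<Longrightarrow> q i \<in> carrier H" and q_nontrivial: "i \<in> {1..p} \<Longrightarrow> q i \<noteq> hone H"
  using invol by (auto simp: involution_def)

lemma factors_inter: "i \<in> {1..p} \<Longrightarrow> factors i \<inter> hprod_except H factors p i = {hone H}"
  and carrier_eq: "i \<in> {1..p} \<Longrightarrow> carrier H = hset_mult H (factors i) (hprod_except H factors p i)"
  using product by (simp_all add: direct_product_def)

lemma q_notin_hprod_except: "i \<in> {1..p} \<Longrightarrow> q i \<notin> hprod_except H factors p i"
  using factors_inter[of i] factors_eq[of i] q_nontrivial[of i] by auto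

lemma factors_closed: "i \<in> {1..p} \<Longrightarrow> factors i \<subseteq> carrier H"
  using factors_eq q_closed by auto

lemma coord_in_factors: "i \<in> {1..p} \<Longrightarrow> coord X i \<in> factors i"
  using factors_eq by (auto simp: coord_def)

lemma coord_closed: "i \<in> {1..p} \<Longrightarrow> coord X i \<in> carrier H"
  using coord_in_factors factors_closed by blast

text \<open>Select \<open>q j\<close> at index \<open>j\<close> and the neutral element elsewhere.
  Together with the trivial intersections this forces the \<open>q i\<close> to be pairwise
  distinct.\<close>

lemma mem_hprod_except:
  assumes "j \<in> {1..p}" "i \<in> {1..p}" "j \<noteq> i"
  shows "q j \<in> hprod_except H factors p i"
proof -
  let ?xs = "filter (\<lambda>j. j \<noteq> i) [1..<Suc p]"
  let ?F = "\<lambda>k. if k = j then {q j} else {hone H}"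
  have c: "?F k \<subseteq> carrier H" for k
    using q_closed[OF assms(1)] by simp
  have "hprod H (map ?F xs) = {hone H}" if "j \<notin> set xs" for xs
    using that by (induction xs) auto
  note triv = this[of "filter (\<lambda>k. k \<noteq> j) ?xs"]
  have "hprod H (map ?F ?xs) = hset_mult H (?F j) (hprod H (map ?F (filter (\<lambda>k. k \<noteq> j) ?xs)))"
    by (rule hprod_extract) (use assms c q_closed[OF assms(1)] in \<open>auto simp del: filter_filter\<close>)
  also have "\<dots> = {q j}"
    using triv q_closed[OF assms(1)] by simp
  finally have "q j \<in> hprod H (map ?F ?xs)"
    by simp
  also have "\<dots> \<subseteq> hprod H (map factors ?xs)"
    by (rule hprod_mono) (auto simp: factors_eq simp del: upt_Suc)
  finally show ?thesis
    by (simp add: hprod_except_def)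
qed

lemma q_inj: "inj_on q {1..p}"
  using mem_hprod_except q_notin_hprod_except by (metis inj_onI)

text \<open>Normality only says that \<open>{e, q i}\<close> and \<open>q j\<close> commute. This gives the claim up to adjoining
  \<open>q j\<close> on both sides, and \<open>q j\<close> lies in neither product.\<close>

lemma q_commute:
  assumes ij: "i \<in> {1..p}" "j \<in> {1..p}" "i \<noteq> j"
  shows "hmult H (q i) (q j) = hmult H (q j) (q i)"
proof -
  have c: "q i \<in> carrier H" "q j \<in> carrier H"
    using q_closed ij by auto
  have "normal_closed_subset H (factors i)"
    using product ij by (simp add: direct_product_def)
  then have "hset_mult H {hone H, q i} {q j} = hset_mult H {q j} {hone H, q i}"
    using c ij by (simp add: normal_closed_subset_def factors_eq)
  then have *: "insert (q j) (hmult H (q i) (q j)) = insert (q j) (hmult H (q j) (q i))"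
    using c by (simp add: hset_mult_def)
  have "q i \<noteq> q j"
    using inj_onD[OF q_inj] ij by blast
  then have notin: "q i \<notin> hmult H (q j) (q j)"
    using involution_hmult_self(2)[OF invol[OF ij(2)]] q_nontrivial[OF ij(1)] by auto
  have star: "hstar H (q j) = q j"
    using invol ij by (intro involution_hmult_self) auto
  \<comment> \<open>By exchange, membership in either product would put \<open>q i\<close> into the
    square of \<open>q j\<close>, which is contained in {e, \<open>q j\<close>}.\<close>
  have "q j \<notin> hmult H (q i) (q j)"
    using notin exchange1[of "q j" "q i" "q j"] c star by simp
  moreover have "q j \<notin> hmult H (q j) (q i)"
    using notin exchange2[of "q j" "q j" "q i"] c star by simp
  ultimately show ?thesis
    using * by (meson insert_ident)
qed

lemma factors_commute:
  assumes "i \<in> {1..p}" "j \<in> {1..p}" "i \<noteq> j" "F \<subseteq> factors i" "K \<subseteq> factors j"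
  shows "hset_mult H F K = hset_mult H K F"
proof -
  have "hmult H a b = hmult H b a" if "a \<in> factors i" "b \<in> factors j" for a b
    using that assms q_commute[of i j] q_closed factors_eq by auto
  then show ?thesis
    using assms by (force simp: hset_mult_def)
qed

lemma coord_commute:
  assumes "i \<in> {1..p}" "j \<in> {1..p}" "i \<noteq> j"
  shows "hset_mult H {coord X i} {coord Y j} = hset_mult H {coord Y j} {coord X i}"
  by (rule factors_commute[OF assms]) (use assms coord_in_factors in auto)

section \<open>Index sets as coordinates\<close>

lemma set_idx: "set [1..<Suc p] = {1..p}"
  by auto

text \<open>The constraint turns a product into a singleton once it is known to contain an element,
  so nonemptiness comes first. Decompositions are extensional, hence the restriction of
  \<open>coord X\<close> to the indices.\<close>

lemma hprod_coord: "hprod_elems H (coord X) p = {elt X}"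
proof -
  let ?r = "restrict (coord X) {1..p}"
  have eq: "hprod_elems H ?r p = hprod_elems H (coord X) p"
    unfolding hprod_elems_def by (rule arg_cong[of _ _ "hprod H"]) auto
  have "hprod_elems H (coord X) p \<noteq> {}"
    unfolding hprod_elems_def
    by (rule hprod_nonempty) (use set_idx coord_closed in \<open>auto simp del: upt_Suc One_nat_def\<close>)
  moreover have "hprod_elems H (coord X) p \<subseteq> carrier H"
    unfolding hprod_elems_def by (rule hprod_map_closed) (simp add: set_idx coord_closed del: upt_Suc)
  ultimately obtain a where a: "a \<in> hprod_elems H (coord X) p" "a \<in> carrier H"
    by blast
  then have "is_decomposition H factors p a ?r"
    using coord_in_factors eq by (auto simp: is_decomposition_def)
  then have "hprod_elems H (coord X) p = {a}"
    using constrained a eq unfolding constrained_direct_product_def by metis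
  then show ?thesis
    by (simp add: elt_def)
qed

lemma hprod_coord_map: "hprod H (map (\<lambda>i. {coord X i}) [1..<Suc p]) = {elt X}"
  using hprod_coord by (simp add: hprod_elems_def)

lemma elt_closed: "elt X \<in> carrier H"
  using hprod_coord_map[of X] coord_closed hprod_map_closed[of "[1..<Suc p]" "\<lambda>i. {coord X i}"]
  by (simp del: upt_Suc)

lemma elt_empty: "elt {} = hone H"
proof -
  have "hprod H (map (\<lambda>i. {coord {} i}) xs) = {hone H}" for xs
    by (induction xs) (auto simp: coord_def)
  then show ?thesis
    using hprod_coord_map[of "{}"] by simp
qed

text \<open>Every factor has just two elements, so a selection of components is the same thing as a
  set of indices.\<close>

lemma hprod_factors_elements:
  assumes "\<And>i. i \<in> {1..p} \<Longrightarrow> r i \<in> factors i"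
  shows "hprod H (map (\<lambda>i. {r i}) [1..<Suc p]) = {elt {i \<in> {1..p}. r i = q i}}"
proof -
  have "map (\<lambda>i. {r i}) [1..<Suc p] = map (\<lambda>i. {coord {i \<in> {1..p}. r i = q i} i}) [1..<Suc p]"
  proof (intro map_cong refl)
    fix i assume "i \<in> set [1..<Suc p]"
    then have i: "i \<in> {1..p}"
      by (simp only: set_idx)
    then show "{r i} = {coord {i \<in> {1..p}. r i = q i} i}"
      using assms[OF i] factors_eq[OF i] by (auto simp: coord_def)
  qed
  then show ?thesis
    by (simp only: hprod_coord_map)
qed

lemma carrier_subset_elt: "carrier H \<subseteq> elt ` Pow {1..p}"
proof
  fix x assume x: "x \<in> carrier H"
  \<comment> \<open>Index 1 is chosen because putting its factor in front of the others already
    gives the order of the indices, so nothing has to be rearranged.\<close>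
  have idx: "[1..<Suc p] = 1 # [2..<Suc p]"
    using p_pos by (simp add: upt_conv_Cons numeral_2_eq_2 del: upt_Suc)
  have "filter (\<lambda>j. j \<noteq> 1) [2..<Suc p] = [2..<Suc p]"
    by (auto simp: filter_id_conv simp del: upt_Suc)
  then have "hprod_except H factors p 1 = hprod H (map factors [2..<Suc p])"
    by (simp only: hprod_except_def idx) simp
  then have "carrier H = hprod H (map factors [1..<Suc p])"
    using carrier_eq[of 1] p_pos by (simp only: idx) simp
  then obtain r where r: "\<forall>i\<in>set [1..<Suc p]. r i \<in> factors i"
    "x \<in> hprod H (map (\<lambda>i. {r i}) [1..<Suc p])"
    using x mem_hprod_map_iff[of "[1..<Suc p]" x H factors] by (auto simp del: upt_Suc)
  then have "x = elt {i \<in> {1..p}. r i = q i}"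
    using hprod_factors_elements[of r] by (simp only: set_idx) blast
  then show "x \<in> elt ` Pow {1..p}"
    by blast
qed

lemma mem_hmult_coord_iff:
  assumes "i \<in> {1..p}"
  shows "c \<in> hmult H (coord X i) (coord Y i) \<longleftrightarrow>
    c = hone H \<and> i \<notin> sym_diff X Y \<or> c = q i \<and> i \<in> sym_diff X Y \<union> (X \<inter> Y \<inter> thick_idx)"
proof -
  have "hmult H (q i) (q i) = (if thick H (q i) then {hone H, q i} else {hone H})"
    using involution_hmult_self[OF invol[OF assms]] q_closed[OF assms] by (auto simp: thick_def thin_def)
  then show ?thesis
    using assms q_closed[OF assms] by (auto simp: coord_def thick_idx_def)
qed

text \<open>By commutation the product is formed coordinate by coordinate, and the choices in
  different coordinates are independent; this is why a whole interval of index sets appears.\<close>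

lemma hmult_elt:
  assumes "X \<subseteq> {1..p}" "Y \<subseteq> {1..p}"
  shows "hmult H (elt X) (elt Y) =
    elt ` {Z. sym_diff X Y \<subseteq> Z \<and> Z \<subseteq> sym_diff X Y \<union> (X \<inter> Y \<inter> thick_idx)}"
proof -
  let ?xs = "[1..<Suc p]"
  let ?Zs = "{Z. sym_diff X Y \<subseteq> Z \<and> Z \<subseteq> sym_diff X Y \<union> (X \<inter> Y \<inter> thick_idx)}"
  have "hmult H (elt X) (elt Y) =
      hset_mult H (hprod H (map (\<lambda>i. {coord X i}) ?xs)) (hprod H (map (\<lambda>i. {coord Y i}) ?xs))"
    by (simp only: hprod_coord_map hset_mult_singletons)
  also have "\<dots> = hprod H (map (\<lambda>i. hset_mult H {coord X i} {coord Y i}) ?xs)"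
    by (rule hprod_mult, unfold set_idx) (simp_all add: coord_closed coord_commute del: hset_mult_singletons)
  finally have "hmult H (elt X) (elt Y) = hprod H (map (\<lambda>i. hmult H (coord X i) (coord Y i)) ?xs)"
    by simp
  then have mem: "x \<in> hmult H (elt X) (elt Y) \<longleftrightarrow>
      (\<exists>r. (\<forall>i\<in>{1..p}. r i \<in> hmult H (coord X i) (coord Y i)) \<and> x \<in> hprod H (map (\<lambda>i. {r i}) ?xs))"
    for x
    using mem_hprod_map_iff[of ?xs x H "\<lambda>i. hmult H (coord X i) (coord Y i)"]
    by (simp add: atLeastLessThanSuc_atLeastAtMost del: upt_Suc)
  show ?thesis
  proof (intro equalityI subsetI)
    fix x assume "x \<in> hmult H (elt X) (elt Y)"
    then obtain r where r: "\<And>i. i \<in> {1..p} \<Longrightarrow> r i \<in> hmult H (coord X i) (coord Y i)"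
      "x \<in> hprod H (map (\<lambda>i. {r i}) ?xs)"
      using mem by blast
    let ?Z = "{i \<in> {1..p}. r i = q i}"
    have "r i \<in> factors i" if "i \<in> {1..p}" for i
      using r(1)[OF that] mem_hmult_coord_iff[OF that] factors_eq[OF that] by auto
    then have "x = elt ?Z"
      using hprod_factors_elements[of r] r(2) by simp
    moreover have "?Z \<in> ?Zs"
    proof -
      have "i \<in> sym_diff X Y \<Longrightarrow> r i = q i"
        and "r i = q i \<Longrightarrow> i \<in> sym_diff X Y \<union> (X \<inter> Y \<inter> thick_idx)" if i: "i \<in> {1..p}" for i
        using r(1)[OF i] q_nontrivial[OF i] unfolding mem_hmult_coord_iff[OF i] by auto
      then show ?thesis
        using assms by blast
    qed
    ultimately show "x \<in> elt ` ?Zs"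
      by blast
  next
    fix x assume "x \<in> elt ` ?Zs"
    then obtain Z where Z: "Z \<in> ?Zs" "x = elt Z"
      by blast
    have "coord Z i \<in> hmult H (coord X i) (coord Y i)" if i: "i \<in> {1..p}" for i
    proof (cases "i \<in> Z")
      case True
      then show ?thesis
        using Z(1) unfolding mem_hmult_coord_iff[OF i] by (auto simp: coord_def)
    next
      case False
      then show ?thesis
        using Z(1) unfolding mem_hmult_coord_iff[OF i] by (auto simp: coord_def)
    qed
    then show "x \<in> hmult H (elt X) (elt Y)"
      using mem Z(2) hprod_coord_map[of Z] by blast
  qed
qed

text \<open>If \<open>i \<in> Z\<close>, split off \<open>q i\<close>: e lies in q_i x with x a
  product over the other indices. Then x is the inverse of q_i, that is q_i itself, against the
  trivial intersection.\<close>

lemma elt_eq_hone_imp_empty: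
  assumes "Z \<subseteq> {1..p}" "elt Z = hone H"
  shows "Z = {}"
proof (rule ccontr)
  assume "Z \<noteq> {}"
  then obtain i where i: "i \<in> Z" "i \<in> {1..p}"
    using assms(1) by blast
  let ?R = "hprod H (map (\<lambda>j. {coord Z j}) (filter (\<lambda>j. j \<noteq> i) [1..<Suc p]))"
  have "hprod H (map (\<lambda>j. {coord Z j}) [1..<Suc p]) = hset_mult H {coord Z i} ?R"
    by (rule hprod_extract, unfold set_idx)
      (use i in \<open>simp_all add: coord_closed coord_commute del: hset_mult_singletons\<close>)
  then have "hone H \<in> hset_mult H {q i} ?R"
    using assms(2) i hprod_coord_map[of Z] by (simp add: coord_def del: upt_Suc)
  then obtain x where x: "x \<in> ?R" "hone H \<in> hmult H (q i) x"
    by (auto simp: hset_mult_def)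
  have R: "?R \<subseteq> hprod_except H factors p i"
    unfolding hprod_except_def by (rule hprod_mono) (use coord_in_factors in auto)
  have "?R \<subseteq> carrier H"
    by (rule hprod_map_closed) (use coord_closed in auto)
  then have "hstar H (q i) = x"
    using x q_closed[OF i(2)] by (intro hstar_eqI) auto
  then have "x = q i"
    using involution_hmult_self(1)[OF invol[OF i(2)]] by simp
  then show False
    using x R q_notin_hprod_except[OF i(2)] by blast
qed

lemma hone_in_hmult_elt_self: "X \<subseteq> {1..p} \<Longrightarrow> hone H \<in> hmult H (elt X) (elt X)"
  unfolding hmult_elt by (rule image_eqI[of _ _ "{}"]) (auto simp: elt_empty)

lemma hstar_elt: "X \<subseteq> {1..p} \<Longrightarrow> hstar H (elt X) = elt X"
  by (intro hstar_eqI elt_closed hone_in_hmult_elt_self)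

text \<open>Equal elements have e in their product, so e = \<open>elt Z\<close> for some
  \<open>Z\<close> containing the symmetric difference of \<open>X\<close> and \<open>Y\<close>; but
  such a \<open>Z\<close> is empty.\<close>

lemma elt_inj: "inj_on elt (Pow {1..p})"
proof (rule inj_onI)
  fix X Y assume XY: "X \<in> Pow {1..p}" "Y \<in> Pow {1..p}" "elt X = elt Y"
  then have "hone H \<in> hmult H (elt X) (elt Y)"
    using hone_in_hmult_elt_self[of X] by simp
  then have "hone H \<in> elt ` {Z. sym_diff X Y \<subseteq> Z \<and> Z \<subseteq> sym_diff X Y \<union> (X \<inter> Y \<inter> thick_idx)}"
    using XY(1,2) by (simp only: hmult_elt Pow_iff)
  then obtain Z where Z: "hone H = elt Z"
    "Z \<in> {Z. sym_diff X Y \<subseteq> Z \<and> Z \<subseteq> sym_diff X Y \<union> (X \<inter> Y \<inter> thick_idx)}"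
    by (rule imageE)
  then have "Z = {}"
    using XY(1,2) by (intro elt_eq_hone_imp_empty) auto
  then have "sym_diff X Y = {}"
    using Z(2) by blast
  then show "X = Y"
    by blast
qed

lemma elt_bij: "bij_betw elt (Pow {1..p}) (carrier H)"
  using elt_inj carrier_subset_elt elt_closed by (auto simp: bij_betw_def)

section \<open>Supports and numbers of thick elements\<close>

lemma supp_elt:
  assumes "X \<subseteq> {1..p}"
  shows "supp H factors p (elt X) = q ` X"
proof -
  have "(THE r. is_decomposition H factors p (elt X) r) = restrict (coord X) {1..p}"
  proof (rule the_equality)
    have "hprod_elems H (restrict (coord X) {1..p}) p = hprod_elems H (coord X) p"
      unfolding hprod_elems_def by (rule arg_cong[of _ _ "hprod H"]) auto
    then show "is_decomposition H factors p (elt X) (restrict (coord X) {1..p})"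
      using coord_in_factors hprod_coord by (auto simp: is_decomposition_def)
  next
    fix r assume "is_decomposition H factors p (elt X) r"
    then have r: "r \<in> (\<Pi>\<^sub>E i\<in>{1..p}. factors i)" "elt X \<in> hprod H (map (\<lambda>i. {r i}) [1..<Suc p])"
      by (auto simp: is_decomposition_def hprod_elems_def)
    then have "r i \<in> factors i" if "i \<in> {1..p}" for i
      using that by (blast dest: PiE_mem)
    then have "elt X = elt {i \<in> {1..p}. r i = q i}"
      using r(2) hprod_factors_elements[of r] by blast
    \<comment> \<open>Injectivity of \<open>elt\<close> is the uniqueness of components that gives
      the \<open>THE\<close> in \<open>supp\<close> its meaning.\<close>
    then have "X = {i \<in> {1..p}. r i = q i}"
      using assms elt_inj by (auto dest!: inj_onD)
    then have "r i = coord X i" if "i \<in> {1..p}" for i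
      using that r(1) factors_eq[OF that] by (auto simp: coord_def PiE_iff)
    then show "r = restrict (coord X) {1..p}"
      using r(1) by (intro extensionalityI[of _ "{1..p}"]) (auto simp: PiE_iff)
  qed
  moreover have "coord X ` {1..p} - {hone H} = q ` X"
    using assms q_nontrivial by (force simp: coord_def)
  ultimately show ?thesis
    by (simp add: supp_def image_restrict_eq)
qed

lemma thick_q_image: "X \<subseteq> {1..p} \<Longrightarrow> card {x \<in> q ` X. thick H x} = card (X \<inter> thick_idx)"
proof -
  assume X: "X \<subseteq> {1..p}"
  then have "{x \<in> q ` X. thick H x} = q ` (X \<inter> thick_idx)"
    by (auto simp: thick_idx_def)
  then show ?thesis
    by (simp only:) (rule card_image, rule inj_on_subset[OF q_inj], use X in blast)
qed

lemma s_elem_elt: "X \<subseteq> {1..p} \<Longrightarrow> s_elem H q p (elt X) = card (X \<inter> thick_idx)"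
  by (simp add: s_elem_def supp_elt thick_q_image)

lemma p_sharp_eq: "p_sharp H q p = card thick_idx"
proof -
  have "{1..p} \<inter> thick_idx = thick_idx"
    by (auto simp: thick_idx_def)
  then show ?thesis
    using thick_q_image[of "{1..p}"] by (simp add: p_sharp_def)
qed

end

section \<open>Vectors over the field with two elements\<close>

lemma bit_add_self [simp]: "(x :: bit) + x = 0"
  by (cases x) auto

lemma bit_vec_add_self:
  fixes v :: "bit vec"
  assumes "v \<in> carrier_vec m"
  shows "v + v = 0\<^sub>v m"
  using assms by (intro eq_vecI) auto

lemma mult_mat_unit_vec_index:
  fixes M :: "'c :: semiring_1 mat"
  assumes "M \<in> carrier_mat n m" "i < n" "j < m"
  shows "(M *\<^sub>v unit_vec m j) $ i = M $$ (i, j)"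
  using assms by (simp add: scalar_prod_right_unit)

lemma mat_eq_if_mult_vec_eq:
  fixes A B :: "'c :: semiring_1 mat"
  assumes "A \<in> carrier_mat n m" "B \<in> carrier_mat n m"
    and "\<And>v. v \<in> carrier_vec m \<Longrightarrow> A *\<^sub>v v = B *\<^sub>v v"
  shows "A = B"
proof (rule eq_matI)
  fix i j assume "i < dim_row B" "j < dim_col B"
  then show "A $$ (i, j) = B $$ (i, j)"
    using assms mult_mat_unit_vec_index[of A n m i j] mult_mat_unit_vec_index[of B n m i j] by auto
qed (use assms in auto)

text \<open>With 0 and 1 as the only scalars, additivity is already linearity. The columns are the
  images of the unit vectors, and every vector is reached from zero by adding unit vectors.\<close>

lemma additive_bit_vec_matrix:
  fixes h :: "bit vec \<Rightarrow> bit vec"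
  assumes closed: "\<And>v. v \<in> carrier_vec m \<Longrightarrow> h v \<in> carrier_vec m"
    and add: "\<And>v w. v \<in> carrier_vec m \<Longrightarrow> w \<in> carrier_vec m \<Longrightarrow> h (v + w) = h v + h w"
  obtains M where "M \<in> carrier_mat m m" "\<And>v. v \<in> carrier_vec m \<Longrightarrow> h v = M *\<^sub>v v"
proof
  define M where "M = mat m m (\<lambda>(i, j). h (unit_vec m j) $ i)"
  show M: "M \<in> carrier_mat m m"
    by (simp add: M_def)
  have unit: "h (unit_vec m j) = M *\<^sub>v unit_vec m j" if "j < m" for j
    using closed[OF unit_vec_carrier, of j] M that
    by (intro eq_vecI) (auto simp: scalar_prod_right_unit, simp add: M_def)
  have zero: "h (0\<^sub>v m) = 0\<^sub>v m"
  proof -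
    have "h (0\<^sub>v m) = h (0\<^sub>v m) + h (0\<^sub>v m)"
      using add[of "0\<^sub>v m" "0\<^sub>v m"] by simp
    then show ?thesis
      using bit_vec_add_self[OF closed[of "0\<^sub>v m"]] by simp
  qed
  \<comment> \<open>Induction on a bound for the support: all entries from position \<open>k\<close>
    on vanish, which for \<open>k = m\<close> says nothing.\<close>
  have "h v = M *\<^sub>v v" if "k \<le> m" "v \<in> carrier_vec m" "\<forall>i<m. k \<le> i \<longrightarrow> v $ i = 0" for k v
    using that
  proof (induction k arbitrary: v)
    case 0
    then have "v = 0\<^sub>v m"
      by (intro eq_vecI) auto
    moreover have "M *\<^sub>v 0\<^sub>v m = 0\<^sub>v m"
      using M by (intro eq_vecI) auto
    ultimately show ?case
      using zero by simp
  next
    case (Suc k)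
    show ?case
    proof (cases "v $ k = 0")
      case True
      then show ?thesis
        using Suc.prems by (intro Suc.IH) (auto simp: le_eq_less_or_eq)
    next
      case False
      \<comment> \<open>Here entry \<open>k\<close> of \<open>v\<close> is 1. Adding the unit vector
        clears it, and adding it once more gives back \<open>v\<close>.\<close>
      let ?u = "unit_vec m k" and ?w = "v + unit_vec m k"
      have c: "v \<in> carrier_vec m" "?u \<in> carrier_vec m" "?w \<in> carrier_vec m"
        using Suc.prems by auto
      have v: "v = ?w + ?u"
        using c bit_vec_add_self[OF c(2)] by (simp add: assoc_add_vec[of _ m])
      have "h ?w = M *\<^sub>v ?w"
        using Suc.prems False by (intro Suc.IH) (auto simp: le_eq_less_or_eq)
      then have "h (?w + ?u) = M *\<^sub>v ?w + M *\<^sub>v ?u"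
        using add[OF c(3) c(2)] unit[of k] Suc.prems by simp
      also have "\<dots> = M *\<^sub>v (?w + ?u)"
        by (rule mult_add_distrib_mat_vec[OF M c(3) c(2), symmetric])
      finally show ?thesis
        using v by simp
    qed
  qed
  from this[OF le_refl] show "h v = M *\<^sub>v v" if "v \<in> carrier_vec m" for v
    using that by simp
qed

lemma bij_betw_bit_vec_Pow:
  "bij_betw (\<lambda>v :: bit vec. {i. i < m \<and> v $ i = 1}) (carrier_vec m) (Pow {..<m})"
proof (rule bij_betw_byWitness[where f' = "\<lambda>X. vec m (\<lambda>i. if i \<in> X then 1 else 0)"])
  show "\<forall>v\<in>carrier_vec m. vec m (\<lambda>i. if i \<in> {i. i < m \<and> v $ i = (1 :: bit)} then 1 else 0) = v"
  proof
    fix v :: "bit vec" assume "v \<in> carrier_vec m"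
    then show "vec m (\<lambda>i. if i \<in> {i. i < m \<and> v $ i = 1} then 1 else 0) = v"
      by (intro eq_vecI) (auto simp: bit_not_one_iff[symmetric] simp del: bit_not_one_iff)
  qed
qed (auto split: if_splits)

lemma finite_carrier_bit_vec: "finite (carrier_vec m :: bit vec set)"
  and card_carrier_bit_vec: "card (carrier_vec m :: bit vec set) = 2 ^ m"
  using bij_betw_finite[OF bij_betw_bit_vec_Pow] bij_betw_same_card[OF bij_betw_bit_vec_Pow]
  by (simp_all add: card_Pow)

text \<open>Such a family is a vector space under symmetric difference, and \<open>m\<close> is its
  dimension. In the induction on the ground set the members avoiding the new point form a subspace,
  which is either everything or becomes everything on adjoining one member that contains the
  point.\<close>

lemma sym_diff_closed_coordinates:
  assumes "finite U" "V \<subseteq> Pow U" "{} \<in> V"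
    and "\<And>X Y. X \<in> V \<Longrightarrow> Y \<in> V \<Longrightarrow> sym_diff X Y \<in> V"
  shows "\<exists>m \<beta>. bij_betw \<beta> (carrier_vec m :: bit vec set) V \<and>
    (\<forall>v\<in>carrier_vec m. \<forall>w\<in>carrier_vec m. \<beta> (v + w) = sym_diff (\<beta> v) (\<beta> w))"
  using assms
proof (induction U arbitrary: V rule: finite_induct)
  case empty
  have "carrier_vec 0 = {0\<^sub>v 0 :: bit vec}"
    by (auto simp: zero_vec_def)
  moreover have "V = {{}}"
    using empty by auto
  ultimately have "bij_betw (\<lambda>_. {}) (carrier_vec 0 :: bit vec set) V"
    by (simp add: bij_betw_def)
  then show ?case
    by (intro exI[of _ 0] exI[of _ "\<lambda>_. {}"]) auto
next
  case (insert x U)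
  let ?V = "{X \<in> V. x \<notin> X}"
  have "\<exists>m \<beta>. bij_betw \<beta> (carrier_vec m :: bit vec set) ?V \<and>
    (\<forall>v\<in>carrier_vec m. \<forall>w\<in>carrier_vec m. \<beta> (v + w) = sym_diff (\<beta> v) (\<beta> w))"
    by (rule insert.IH) (use insert.prems in auto)
  then obtain m and \<beta> :: "bit vec \<Rightarrow> 'a set" where \<beta>: "bij_betw \<beta> (carrier_vec m) ?V"
    and add: "\<And>v w. v \<in> carrier_vec m \<Longrightarrow> w \<in> carrier_vec m \<Longrightarrow> \<beta> (v + w) = sym_diff (\<beta> v) (\<beta> w)"
    by blast
  show ?case
  proof (cases "?V = V")
    case True
    then show ?thesis
      using \<beta> add by metis
  next
    case False
    then obtain T where T: "T \<in> V" "x \<in> T"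
      by blast
    define ini where "ini v = vec m (\<lambda>i. v $ i)" for v :: "bit vec"
    \<comment> \<open>The new last coordinate tells whether \<open>T\<close> is added. It can be
      recovered from the value, because \<open>x\<close> lies in \<open>T\<close> but in no member
      of \<open>?V\<close>.\<close>
    define \<beta>' where "\<beta>' v = (if v $ m = 1 then sym_diff (\<beta> (ini v)) T else \<beta> (ini v))" for v
    have ini_carrier: "ini v \<in> carrier_vec m" for v
      by (simp add: ini_def)
    have \<beta>V: "\<beta> v \<in> V" "x \<notin> \<beta> v" if "v \<in> carrier_vec m" for v
      using bij_betwE[OF \<beta>] that by auto
    have mem: "x \<in> \<beta>' v \<longleftrightarrow> v $ m = 1" for v
      using T \<beta>V[OF ini_carrier[of v]] by (auto simp: \<beta>'_def)
    have vec_eqI: "v = w" if "v \<in> carrier_vec (Suc m)" "w \<in> carrier_vec (Suc m)" "v $ m = w $ m"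
      "ini v = ini w" for v w
    proof (rule eq_vecI)
      fix i assume "i < dim_vec w"
      then have "i < Suc m"
        using that by simp
      then consider "i < m" | "i = m"
        by linarith
      then show "v $ i = w $ i"
      proof cases
        case 1
        then have "ini v $ i = ini w $ i"
          using that by simp
        then show ?thesis
          using 1 by (simp add: ini_def)
      qed (use that in simp)
    qed (use that in auto)
    have "bij_betw \<beta>' (carrier_vec (Suc m)) V"
    proof (rule bij_betw_imageI)
      show "inj_on \<beta>' (carrier_vec (Suc m))"
      proof (rule inj_onI)
        fix v w :: "bit vec" assume vw: "v \<in> carrier_vec (Suc m)" "w \<in> carrier_vec (Suc m)" "\<beta>' v = \<beta>' w"
        have last: "v $ m = w $ m"
          using mem[of v] mem[of w] vw(3) by (metis bit_not_one_iff)
        then have "\<beta> (ini v) = \<beta> (ini w)"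
          using vw(3) by (auto simp: \<beta>'_def split: if_splits)
        then have "ini v = ini w"
          using \<beta> ini_carrier by (auto simp: bij_betw_def dest: inj_onD)
        then show "v = w"
          using vec_eqI[OF vw(1,2) last] by blast
      qed
      have onto: "\<exists>v\<in>carrier_vec (Suc m). ini v = u \<and> v $ m = b" if "u \<in> carrier_vec m" for u b
        by (intro bexI[of _ "vec (Suc m) (\<lambda>i. if i < m then u $ i else b)"] conjI eq_vecI)
          (use that in \<open>auto simp: ini_def\<close>)
      show "\<beta>' ` carrier_vec (Suc m) = V"
      proof (intro equalityI subsetI)
        fix Y assume "Y \<in> \<beta>' ` carrier_vec (Suc m)"
        then show "Y \<in> V"
          using \<beta>V[OF ini_carrier] T insert.prems(3) by (auto simp: \<beta>'_def)
      next
        fix Y assume Y: "Y \<in> V"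
        \<comment> \<open>If \<open>x \<in> Y\<close>, adding \<open>T\<close> brings
          \<open>Y\<close> into the subspace; the last coordinate 1 makes \<open>\<beta>'\<close>
          add \<open>T\<close> again.\<close>
        define Y' where "Y' = (if x \<in> Y then sym_diff Y T else Y)"
        have "Y' \<in> ?V"
          using Y T insert.prems(3) by (auto simp: Y'_def)
        then obtain u where u: "u \<in> carrier_vec m" "Y' = \<beta> u"
          using \<beta> by (auto simp: bij_betw_def)
        obtain v where v: "v \<in> carrier_vec (Suc m)" "ini v = u" "v $ m = (if x \<in> Y then 1 else 0)"
          using onto[OF u(1)] by blast
        have "Y = \<beta>' v"
          unfolding \<beta>'_def v u(2)[symmetric] by (auto simp: Y'_def)
        then show "Y \<in> \<beta>' ` carrier_vec (Suc m)"
          using v by blast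
      qed
    qed
    moreover have "\<beta>' (v + w) = sym_diff (\<beta>' v) (\<beta>' w)"
      if "v \<in> carrier_vec (Suc m)" "w \<in> carrier_vec (Suc m)" for v w
    proof -
      have "ini (v + w) = ini v + ini w"
        using that by (intro eq_vecI) (auto simp: ini_def)
      moreover have "(v + w) $ m = v $ m + w $ m"
        using that by simp
      ultimately show ?thesis
        using add[OF ini_carrier ini_carrier, of v w]
        by (cases "v $ m"; cases "w $ m") (auto simp: \<beta>'_def)
    qed
    ultimately show ?thesis
      by blast
  qed
qed

text \<open>Injective images respect symmetric differences. This serves twice: for a permutation
  acting on subsets, and for the numbering of the thick indices of a closed subset.\<close>

lemma image_sym_diff_interval:
  assumes "inj_on \<sigma> D" "A \<subseteq> D" "B \<subseteq> D"
  shows "(`) \<sigma> ` {C. sym_diff A B \<subseteq> C \<and> C \<subseteq> A \<union> B} =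
    {C. sym_diff (\<sigma> ` A) (\<sigma> ` B) \<subseteq> C \<and> C \<subseteq> \<sigma> ` A \<union> \<sigma> ` B}"
proof -
  have eq: "sym_diff (\<sigma> ` A) (\<sigma> ` B) = \<sigma> ` sym_diff A B"
    using assms inj_on_image_set_diff[of \<sigma> D A B] inj_on_image_set_diff[of \<sigma> D B A]
    by (simp add: image_Un Diff_subset subset_trans[OF Diff_subset])
  show ?thesis
  proof (intro equalityI subsetI)
    fix C' assume "C' \<in> {C. sym_diff (\<sigma> ` A) (\<sigma> ` B) \<subseteq> C \<and> C \<subseteq> \<sigma> ` A \<union> \<sigma> ` B}"
    then have C': "\<sigma> ` sym_diff A B \<subseteq> C'" "C' \<subseteq> \<sigma> ` (A \<union> B)"
      by (simp_all only: eq image_Un mem_Collect_eq)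
    then obtain C where C: "C \<subseteq> A \<union> B" "C' = \<sigma> ` C"
      by (auto elim: subset_imageE)
    have "sym_diff A B \<subseteq> C"
    proof
      fix x assume x: "x \<in> sym_diff A B"
      then have "\<sigma> x \<in> \<sigma> ` C"
        using C'(1) C(2) by blast
      moreover have "x \<in> D" "C \<subseteq> D"
        using x C assms by auto
      ultimately show "x \<in> C"
        using inj_on_image_mem_iff[OF assms(1)] by blast
    qed
    then show "C' \<in> (`) \<sigma> ` {C. sym_diff A B \<subseteq> C \<and> C \<subseteq> A \<union> B}"
      using C by blast
  next
    fix C' assume "C' \<in> (`) \<sigma> ` {C. sym_diff A B \<subseteq> C \<and> C \<subseteq> A \<union> B}"
    then obtain C where C: "sym_diff A B \<subseteq> C" "C \<subseteq> A \<union> B" "C' = \<sigma> ` C"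
      by blast
    then have "\<sigma> ` sym_diff A B \<subseteq> C'" "C' \<subseteq> \<sigma> ` (A \<union> B)"
      by (simp_all only: image_mono)
    then show "C' \<in> {C. sym_diff (\<sigma> ` A) (\<sigma> ` B) \<subseteq> C \<and> C \<subseteq> \<sigma> ` A \<union> \<sigma> ` B}"
      by (simp only: eq image_Un mem_Collect_eq)
  qed
qed

text \<open>Only indices in \<open>T\<close> are optional. Inside \<open>T\<close> the symmetric
  difference together with the optional indices is the union \<open>A \<union> B\<close>, while the
  part outside \<open>T\<close> is fixed.\<close>

lemma interval_disjoint_union:
  assumes "A \<subseteq> T" "B \<subseteq> T" "V \<inter> T = {}" "W \<inter> T = {}"
  shows "{Z. sym_diff (A \<union> V) (B \<union> W) \<subseteq> Z \<and>
      Z \<subseteq> sym_diff (A \<union> V) (B \<union> W) \<union> ((A \<union> V) \<inter> (B \<union> W) \<inter> T)} =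
    (\<lambda>C. C \<union> sym_diff V W) ` {C. sym_diff A B \<subseteq> C \<and> C \<subseteq> A \<union> B}"
proof -
  have sd: "sym_diff (A \<union> V) (B \<union> W) = sym_diff A B \<union> sym_diff V W"
    using assms by auto
  have int: "(A \<union> V) \<inter> (B \<union> W) \<inter> T = A \<inter> B"
    using assms by auto
  show ?thesis
    unfolding sd int
  proof (intro equalityI subsetI)
    fix Z assume "Z \<in> {Z. sym_diff A B \<union> sym_diff V W \<subseteq> Z \<and>
      Z \<subseteq> sym_diff A B \<union> sym_diff V W \<union> A \<inter> B}"
    then have Z: "sym_diff A B \<subseteq> Z" "sym_diff V W \<subseteq> Z" "Z \<subseteq> A \<union> B \<union> sym_diff V W"
      by auto
    show "Z \<in> (\<lambda>C. C \<union> sym_diff V W) ` {C. sym_diff A B \<subseteq> C \<and> C \<subseteq> A \<union> B}"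
    proof (rule image_eqI)
      show "Z = (Z \<inter> (A \<union> B)) \<union> sym_diff V W"
        using Z(2,3) by auto
      show "Z \<inter> (A \<union> B) \<in> {C. sym_diff A B \<subseteq> C \<and> C \<subseteq> A \<union> B}"
        using Z(1) by auto
    qed
  next
    fix Z assume "Z \<in> (\<lambda>C. C \<union> sym_diff V W) ` {C. sym_diff A B \<subseteq> C \<and> C \<subseteq> A \<union> B}"
    then obtain C where C: "Z = C \<union> sym_diff V W" "sym_diff A B \<subseteq> C" "C \<subseteq> A \<union> B"
      by blast
    have "sym_diff A B \<union> sym_diff V W \<subseteq> Z"
      using C(2) unfolding C(1) by (rule Un_mono[OF _ subset_refl])
    moreover have "Z \<subseteq> sym_diff A B \<union> sym_diff V W \<union> A \<inter> B"
      using C(3) unfolding C(1) by auto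
    ultimately show "Z \<in> {Z. sym_diff A B \<union> sym_diff V W \<subseteq> Z \<and>
      Z \<subseteq> sym_diff A B \<union> sym_diff V W \<union> A \<inter> B}"
      by blast
  qed
qed

section \<open>Invertible matrices over the field with two elements\<close>

lemma carrier_GL2:
  "M \<in> carrier (GL2 m) \<longleftrightarrow>
    M \<in> carrier_mat m m \<and> (\<exists>N\<in>carrier_mat m m. N * M = 1\<^sub>m m \<and> M * N = 1\<^sub>m m)"
  by (auto simp: GL2_def units_of_def Units_def ring_mat_simps)

lemma mult_GL2: "M \<otimes>\<^bsub>GL2 m\<^esub> N = M * N"
  by (simp add: GL2_def units_of_def ring_mat_simps)

lemma group_GL2: "group (GL2 m)"
proof -
  interpret ring "ring_mat TYPE(bit) m ()"
    by (rule ring_mat)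
  show ?thesis
    unfolding GL2_def by (rule units_group)
qed

section \<open>Automorphisms in coordinates\<close>

text \<open>The model Pow S x V, with S numbered by {1..s} and V written as column vectors. The
  automorphism group is computed from this multiplication rule, without reference to
  \<open>q\<close> and \<open>p\<close>.\<close>

locale cube_vector_coordinates =
  fixes H :: "('a, 'b) hyperstruct_scheme" and G :: "'a set" and s m :: nat
    and c :: "nat set \<Rightarrow> bit vec \<Rightarrow> 'a"
  assumes bij: "bij_betw (\<lambda>(A, v). c A v) (Pow {1..s} \<times> carrier_vec m) G"
    and mult: "\<lbrakk>A \<subseteq> {1..s}; B \<subseteq> {1..s}; v \<in> carrier_vec m; w \<in> carrier_vec m\<rbrakk> \<Longrightarrow>
      hmult H (c A v) (c B w) = (\<lambda>C. c C (v + w)) ` {C. sym_diff A B \<subseteq> C \<and> C \<subseteq> A \<union> B}"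
    and one: "c {} (0\<^sub>v m) = hone H"
begin

lemma c_in: "A \<subseteq> {1..s} \<Longrightarrow> v \<in> carrier_vec m \<Longrightarrow> c A v \<in> G"
  using bij_betwE[OF bij] by auto

lemma c_eq_iff:
  assumes "A \<subseteq> {1..s}" "B \<subseteq> {1..s}" "v \<in> carrier_vec m" "w \<in> carrier_vec m"
  shows "c A v = c B w \<longleftrightarrow> A = B \<and> v = w"
  using inj_onD[OF bij_betw_imp_inj_on[OF bij], of "(A, v)" "(B, w)"] assms by auto

lemma c_cases:
  assumes "x \<in> G"
  obtains A v where "A \<subseteq> {1..s}" "v \<in> carrier_vec m" "x = c A v"
  using assms bij by (auto simp: bij_betw_def)

text \<open>Squares forget \<open>v\<close> and show exactly \<open>A\<close>. Automorphisms
  therefore recognise the elements with \<open>v\<close> zero (members of their own square) and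
  those with \<open>A\<close> empty (square {e}).\<close>

lemma mult_self:
  assumes "A \<subseteq> {1..s}" "v \<in> carrier_vec m"
  shows "hmult H (c A v) (c A v) = (\<lambda>C. c C (0\<^sub>v m)) ` Pow A"
  using assms by (simp add: mult bit_vec_add_self Pow_def)

lemma mult_vec:
  assumes "v \<in> carrier_vec m" "w \<in> carrier_vec m"
  shows "hmult H (c {} v) (c {} w) = {c {} (v + w)}"
  using assms by (simp add: mult)

text \<open>Each element is the sole member of a product of its two parts, so an automorphism is
  known once its values on both parts are.\<close>

lemma mult_cube_vec:
  assumes "A \<subseteq> {1..s}" "v \<in> carrier_vec m"
  shows "hmult H (c A (0\<^sub>v m)) (c {} v) = {c A v}"
proof -
  have "{C. A \<subseteq> C \<and> C \<subseteq> A} = {A}"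
    by auto
  then show ?thesis
    using assms by (simp add: mult)
qed

text \<open>\<open>inv_into\<close> reads off the coordinates of \<open>x\<close>. The function is
  restricted to \<open>G\<close> because \<open>Bij\<close> consists of extensional
  functions.\<close>

definition act :: "(nat \<Rightarrow> nat) \<Rightarrow> bit mat \<Rightarrow> 'a \<Rightarrow> 'a" where
  "act \<pi> M = (\<lambda>x\<in>G. case inv_into (Pow {1..s} \<times> carrier_vec m) (\<lambda>(A, v). c A v) x of
    (A, v) \<Rightarrow> c (\<pi> ` A) (M *\<^sub>v v))"

lemma act_c:
  assumes "A \<subseteq> {1..s}" "v \<in> carrier_vec m"
  shows "act \<pi> M (c A v) = c (\<pi> ` A) (M *\<^sub>v v)"
proof -
  have "inv_into (Pow {1..s} \<times> carrier_vec m) (\<lambda>(A, v). c A v) (c A v) = (A, v)"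
    using inv_into_f_f[OF bij_betw_imp_inj_on[OF bij], of "(A, v)"] assms by auto
  then show ?thesis
    using assms c_in by (simp add: act_def)
qed

lemma permutes_image_subset: "\<pi> permutes {1..s} \<Longrightarrow> A \<subseteq> {1..s} \<Longrightarrow> \<pi> ` A \<subseteq> {1..s}"
  using permutes_image by blast

lemma act_in:
  assumes "\<pi> permutes {1..s}" "M \<in> carrier_mat m m" "x \<in> G"
  shows "act \<pi> M x \<in> G"
proof -
  obtain A v where "A \<subseteq> {1..s}" "v \<in> carrier_vec m" "x = c A v"
    using c_cases[OF assms(3)] .
  then show ?thesis
    using assms(2) permutes_image_subset[OF assms(1)] by (simp add: act_c c_in)
qed

lemma act_act:
  assumes "\<pi>' permutes {1..s}" "M \<in> carrier_mat m m" "M' \<in> carrier_mat m m" "x \<in> G"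
  shows "act \<pi> M (act \<pi>' M' x) = act (\<pi> \<circ> \<pi>') (M * M') x"
proof -
  obtain A v where *: "A \<subseteq> {1..s}" "v \<in> carrier_vec m" "x = c A v"
    using c_cases[OF assms(4)] .
  have "\<pi>' ` A \<subseteq> {1..s}" "M' *\<^sub>v v \<in> carrier_vec m"
    using permutes_image_subset assms * by auto
  then show ?thesis
    using assms * by (simp add: act_c image_comp assoc_mult_mat_vec[of _ m m])
qed

lemma act_id:
  assumes "x \<in> G"
  shows "act id (1\<^sub>m m) x = x"
proof -
  obtain A v where "A \<subseteq> {1..s}" "v \<in> carrier_vec m" "x = c A v"
    using c_cases[OF assms] .
  then show ?thesis
    by (simp add: act_c)
qed

lemma act_Bij:
  assumes "\<pi> permutes {1..s}" "M \<in> carrier (GL2 m)"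
  shows "act \<pi> M \<in> Bij G"
proof -
  obtain N where M: "M \<in> carrier_mat m m" "N \<in> carrier_mat m m" "N * M = 1\<^sub>m m" "M * N = 1\<^sub>m m"
    using assms(2) by (auto simp: carrier_GL2)
  have inv: "inv_into UNIV \<pi> permutes {1..s}" "inv_into UNIV \<pi> \<circ> \<pi> = id" "\<pi> \<circ> inv_into UNIV \<pi> = id"
    using assms(1) by (auto simp: permutes_inv permutes_inv_o)
  have "bij_betw (act \<pi> M) G G"
    by (rule bij_betw_byWitness[where f' = "act (inv_into UNIV \<pi>) N"])
      (use M inv assms(1) in \<open>auto simp: act_act act_id act_in\<close>)
  then show ?thesis
    by (simp add: Bij_def act_def)
qed

lemma act_automorphism:
  assumes \<pi>: "\<pi> permutes {1..s}" and M: "M \<in> carrier (GL2 m)"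
  shows "act \<pi> M \<in> carrier (hAut H G)"
proof -
  have Mc: "M \<in> carrier_mat m m"
    using M by (simp add: carrier_GL2)
  have inj: "inj_on \<pi> {1..s}"
    using \<pi> by (rule permutes_inj_on)
  have zero: "M *\<^sub>v 0\<^sub>v m = 0\<^sub>v m"
    using Mc by (intro eq_vecI) auto
  have "act \<pi> M ` hmult H x y = hmult H (act \<pi> M x) (act \<pi> M y)" if xy: "x \<in> G" "y \<in> G" for x y
  proof -
    obtain A v where x: "A \<subseteq> {1..s}" "v \<in> carrier_vec m" "x = c A v"
      using c_cases[OF xy(1)] .
    obtain B w where y: "B \<subseteq> {1..s}" "w \<in> carrier_vec m" "y = c B w"
      using c_cases[OF xy(2)] .
    let ?I = "{C. sym_diff A B \<subseteq> C \<and> C \<subseteq> A \<union> B}"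
    have "act \<pi> M ` hmult H x y = (\<lambda>C. act \<pi> M (c C (v + w))) ` ?I"
      using x y by (simp add: mult image_image)
    also have "\<dots> = (\<lambda>C. c (\<pi> ` C) (M *\<^sub>v (v + w))) ` ?I"
    proof (rule image_cong[OF refl])
      fix C assume "C \<in> ?I"
      then have "C \<subseteq> {1..s}"
        using x(1) y(1) by blast
      then show "act \<pi> M (c C (v + w)) = c (\<pi> ` C) (M *\<^sub>v (v + w))"
        using x(2) y(2) by (simp add: act_c)
    qed
    also have "\<dots> = (\<lambda>C. c C (M *\<^sub>v v + M *\<^sub>v w)) ` ((`) \<pi> ` ?I)"
      using x y Mc by (simp add: image_image mult_add_distrib_mat_vec[of _ m m])
    also have "\<dots> = hmult H (c (\<pi> ` A) (M *\<^sub>v v)) (c (\<pi> ` B) (M *\<^sub>v w))"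
      unfolding image_sym_diff_interval[OF inj x(1) y(1)]
      by (rule mult[symmetric]) (use x y Mc permutes_image_subset[OF \<pi>] in auto)
    finally show ?thesis
      using x y by (simp add: act_c)
  qed
  moreover have "act \<pi> M (hone H) = hone H"
    using act_c[of "{}" "0\<^sub>v m"] by (simp add: one zero)
  ultimately show ?thesis
    using act_Bij[OF \<pi> M] by (simp add: hAut_def)
qed

lemma act_eq_imp_eq:
  assumes "\<pi> permutes {1..s}" "\<pi>' permutes {1..s}" "M \<in> carrier_mat m m" "M' \<in> carrier_mat m m"
    and eq: "act \<pi> M = act \<pi>' M'"
  shows "\<pi> = \<pi>'" "M = M'"
proof -
  have both: "\<pi> ` A = \<pi>' ` A \<and> M *\<^sub>v v = M' *\<^sub>v v" if "A \<subseteq> {1..s}" "v \<in> carrier_vec m" for A v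
  proof -
    have "c (\<pi> ` A) (M *\<^sub>v v) = c (\<pi>' ` A) (M' *\<^sub>v v)"
      using act_c[OF that, of \<pi> M] act_c[OF that, of \<pi>' M'] eq by simp
    then show ?thesis
      using that assms permutes_image_subset by (subst (asm) c_eq_iff) auto
  qed
  show "M = M'"
    by (rule mat_eq_if_mult_vec_eq) (use assms both[of "{}"] in auto)
  show "\<pi> = \<pi>'"
  proof
    fix i
    \<comment> \<open>Singletons recover the values on {1..s}; outside, both permutations are the
      identity.\<close>
    show "\<pi> i = \<pi>' i"
      using both[of "{i}" "0\<^sub>v m"] permutes_not_in[OF assms(1)] permutes_not_in[OF assms(2)]
      by (cases "i \<in> {1..s}") auto
  qed
qed

lemma automorphism_cube:
  assumes f: "f \<in> carrier (hAut H G)"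
  shows "\<exists>\<pi>. \<pi> permutes {1..s} \<and> (\<forall>A \<subseteq> {1..s}. f (c A (0\<^sub>v m)) = c (\<pi> ` A) (0\<^sub>v m))"
proof -
  have inj: "inj_on f G" and into: "\<And>x. x \<in> G \<Longrightarrow> f x \<in> G"
    and hom: "\<And>x y. x \<in> G \<Longrightarrow> y \<in> G \<Longrightarrow> f ` hmult H x y = hmult H (f x) (f y)"
    using f by (auto simp: hAut_def Bij_def bij_betw_def)
  have "\<exists>B\<subseteq>{1..s}. f (c A (0\<^sub>v m)) = c B (0\<^sub>v m)" if A: "A \<subseteq> {1..s}" for A
  proof -
    let ?x = "c A (0\<^sub>v m)"
    have x: "?x \<in> G"
      using A by (simp add: c_in)
    obtain B w where B: "B \<subseteq> {1..s}" "w \<in> carrier_vec m" "f ?x = c B w"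
      using c_cases[OF into[OF x]] .
    \<comment> \<open>Being a member of its own square passes to the image, and all members of a
      square have vector part zero.\<close>
    have "?x \<in> hmult H ?x ?x"
      using A by (simp add: mult_self)
    then have "f ?x \<in> hmult H (f ?x) (f ?x)"
      using hom[OF x x] by blast
    then show ?thesis
      using B by (auto simp: mult_self)
  qed
  then obtain k where k: "\<And>A. A \<subseteq> {1..s} \<Longrightarrow> k A \<subseteq> {1..s}"
    and fk: "\<And>A. A \<subseteq> {1..s} \<Longrightarrow> f (c A (0\<^sub>v m)) = c (k A) (0\<^sub>v m)"
    by metis
  have k_Pow: "k ` Pow A = Pow (k A)" if A: "A \<subseteq> {1..s}" for A
  proof -
    let ?x = "c A (0\<^sub>v m)"
    have "f ` hmult H ?x ?x = hmult H (c (k A) (0\<^sub>v m)) (c (k A) (0\<^sub>v m))"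
      using hom[of ?x ?x] fk A by (simp add: c_in)
    then have "f ` (\<lambda>C. c C (0\<^sub>v m)) ` Pow A = (\<lambda>C. c C (0\<^sub>v m)) ` Pow (k A)"
      using A k by (simp add: mult_self)
    moreover have "f ` (\<lambda>C. c C (0\<^sub>v m)) ` Pow A = (\<lambda>C. c C (0\<^sub>v m)) ` k ` Pow A"
      unfolding image_image by (rule image_cong) (use A fk in auto)
    moreover have "inj_on (\<lambda>C. c C (0\<^sub>v m)) (Pow {1..s})"
      by (rule inj_onI) (simp add: c_eq_iff)
    moreover have "k ` Pow A \<subseteq> Pow {1..s}" "Pow (k A) \<subseteq> Pow {1..s}"
      using A k by blast+
    ultimately show ?thesis
      using inj_on_image_eq_iff by metis
  qed
  have k_inj: "inj_on k (Pow {1..s})"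
  proof (rule inj_onI)
    fix A B assume AB: "A \<in> Pow {1..s}" "B \<in> Pow {1..s}" "k A = k B"
    then have "f (c A (0\<^sub>v m)) = f (c B (0\<^sub>v m))"
      by (simp add: fk)
    then have "c A (0\<^sub>v m) = c B (0\<^sub>v m)"
      using inj_onD[OF inj] AB by (simp add: c_in)
    then show "A = B"
      using AB by (simp add: c_eq_iff)
  qed
  have k_card: "card (k A) = card A" if A: "A \<subseteq> {1..s}" for A
  proof -
    have fin: "finite A" "finite (k A)"
      using A k[OF A] by (auto intro: finite_subset)
    have "inj_on k (Pow A)"
      using inj_on_subset[OF k_inj] A by blast
    then have "card (Pow (k A)) = card (Pow A)"
      using k_Pow[OF A] card_image by metis
    then show ?thesis
      using fin by (simp add: card_Pow)
  qed
  have "\<exists>j. k {i} = {j}" if "i \<in> {1..s}" for i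
    using k_card[of "{i}"] that by (auto simp: card_1_singleton_iff)
  then obtain \<pi>\<^sub>0 where \<pi>\<^sub>0: "\<And>i. i \<in> {1..s} \<Longrightarrow> k {i} = {\<pi>\<^sub>0 i}"
    by metis
  \<comment> \<open>The choice of \<open>\<pi>\<^sub>0\<close> says nothing outside {1..s}, where
    \<open>permutes\<close> demands the identity.\<close>
  define \<pi> where "\<pi> i = (if i \<in> {1..s} then \<pi>\<^sub>0 i else i)" for i
  have k_single: "k {i} = {\<pi> i}" if "i \<in> {1..s}" for i
    using \<pi>\<^sub>0[OF that] that by (simp add: \<pi>_def)
  have k_image: "k A = \<pi> ` A" if A: "A \<subseteq> {1..s}" for A
  proof (intro equalityI subsetI)
    fix j assume "j \<in> k A"
    then have "{j} \<in> k ` Pow A"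
      using k_Pow[OF A] by blast
    then obtain C where C: "C \<subseteq> A" "{j} = k C"
      by blast
    \<comment> \<open>\<open>k\<close> preserves cardinality, so the subset mapped to a singleton is
      itself a singleton.\<close>
    then have "card C = 1"
      using k_card[of C] A by (metis card.empty card.insert empty_iff finite.emptyI One_nat_def subset_trans)
    then obtain i where "C = {i}"
      by (auto simp: card_1_singleton_iff)
    then show "j \<in> \<pi> ` A"
      using C k_single[of i] A by auto
  next
    fix j assume "j \<in> \<pi> ` A"
    then obtain i where i: "i \<in> A" "j = \<pi> i"
      by blast
    then have "k {i} \<in> Pow (k A)"
      using k_Pow[OF A] by blast
    then show "j \<in> k A"
      using i k_single[of i] A by auto
  qed
  have "inj_on \<pi> {1..s}"
  proof (rule inj_onI)
    fix i j assume ij: "i \<in> {1..s}" "j \<in> {1..s}" "\<pi> i = \<pi> j"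
    then have "k {i} = k {j}"
      by (simp add: k_single del: atLeastAtMost_iff)
    then show "i = j"
      using inj_onD[OF k_inj, of "{i}" "{j}"] ij by simp
  qed
  moreover have "\<pi> ` {1..s} \<subseteq> {1..s}"
    using k[of "{1..s}"] k_image[of "{1..s}"] by simp
  ultimately have "bij_betw \<pi> {1..s} {1..s}"
    by (simp add: bij_betw_def endo_inj_surj)
  then have "\<pi> permutes {1..s}"
    by (rule bij_imp_permutes) (simp only: \<pi>_def if_False)
  then show ?thesis
    using fk k_image by metis
qed

text \<open>Elements with \<open>A\<close> empty are those with square {e}, so \<open>f\<close>
  permutes them. It is additive there because their products are singletons containing the
  sum.\<close>

lemma automorphism_vec:
  assumes f: "f \<in> carrier (hAut H G)"
  shows "\<exists>M\<in>carrier (GL2 m). \<forall>v\<in>carrier_vec m. f (c {} v) = c {} (M *\<^sub>v v)"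
proof -
  have inj: "inj_on f G" and into: "\<And>x. x \<in> G \<Longrightarrow> f x \<in> G" and f_one: "f (hone H) = hone H"
    and hom: "\<And>x y. x \<in> G \<Longrightarrow> y \<in> G \<Longrightarrow> f ` hmult H x y = hmult H (f x) (f y)"
    using f by (auto simp: hAut_def Bij_def bij_betw_def)
  have "\<exists>w\<in>carrier_vec m. f (c {} v) = c {} w" if v: "v \<in> carrier_vec m" for v
  proof -
    let ?x = "c {} v"
    have x: "?x \<in> G"
      using v by (simp add: c_in)
    obtain B w where B: "B \<subseteq> {1..s}" "w \<in> carrier_vec m" "f ?x = c B w"
      using c_cases[OF into[OF x]] .
    \<comment> \<open>The square of the image is {e} as well, which leaves \<open>B\<close> with the
      empty set as its only subset.\<close>
    have "hmult H (f ?x) (f ?x) = f ` {hone H}"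
      using v hom[OF x x] by (simp add: mult_self one)
    then have "(\<lambda>C. c C (0\<^sub>v m)) ` Pow B = {c {} (0\<^sub>v m)}"
      using B by (simp add: mult_self f_one one)
    then have "c B (0\<^sub>v m) = c {} (0\<^sub>v m)"
      by blast
    then show ?thesis
      using B by (auto simp: c_eq_iff)
  qed
  then obtain h where h: "\<And>v. v \<in> carrier_vec m \<Longrightarrow> h v \<in> carrier_vec m"
    and fh: "\<And>v. v \<in> carrier_vec m \<Longrightarrow> f (c {} v) = c {} (h v)"
    by metis
  have add: "h (v + w) = h v + h w" if vw: "v \<in> carrier_vec m" "w \<in> carrier_vec m" for v w
  proof -
    have "f ` hmult H (c {} v) (c {} w) = hmult H (c {} (h v)) (c {} (h w))"
      using hom[of "c {} v" "c {} w"] vw by (simp add: c_in fh)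
    then have "c {} (h (v + w)) = c {} (h v + h w)"
      using vw h by (simp add: mult_vec fh)
    then show ?thesis
      using vw h by (simp add: c_eq_iff)
  qed
  have "inj_on h (carrier_vec m)"
  proof (rule inj_onI)
    fix v w assume vw: "v \<in> carrier_vec m" "w \<in> carrier_vec m" "h v = h w"
    then have "c {} v = c {} w"
      using inj_onD[OF inj, of "c {} v" "c {} w"] by (simp add: c_in fh)
    then show "v = w"
      using vw by (simp add: c_eq_iff)
  qed
  moreover have "h ` carrier_vec m \<subseteq> carrier_vec m"
    using h by blast
  ultimately have h_bij: "bij_betw h (carrier_vec m) (carrier_vec m)"
    using endo_inj_surj[OF finite_carrier_bit_vec] by (auto simp: bij_betw_def)
  \<comment> \<open>The inverse is additive too, so it has a matrix of its own, which witnesses the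
    invertibility of \<open>M\<close>.\<close>
  define h' where "h' = inv_into (carrier_vec m) h"
  have h': "h' v \<in> carrier_vec m" "h (h' v) = v" "h' (h v) = v" if "v \<in> carrier_vec m" for v
    using that h_bij bij_betwE[OF bij_betw_inv_into[OF h_bij]]
    by (auto simp: h'_def bij_betw_inv_into_left bij_betw_inv_into_right)
  have add': "h' (v + w) = h' v + h' w" if "v \<in> carrier_vec m" "w \<in> carrier_vec m" for v w
  proof -
    have "h' v + h' w \<in> carrier_vec m" "h (h' v + h' w) = v + w"
      using that h' by (simp_all add: add)
    then show ?thesis
      using h'(3) by metis
  qed
  obtain M where M: "M \<in> carrier_mat m m" "\<And>v. v \<in> carrier_vec m \<Longrightarrow> h v = M *\<^sub>v v"
    using additive_bit_vec_matrix[of m h] h add by blast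
  obtain N where N: "N \<in> carrier_mat m m" "\<And>v. v \<in> carrier_vec m \<Longrightarrow> h' v = N *\<^sub>v v"
    using additive_bit_vec_matrix[of m h'] h'(1) add' by blast
  have "N * M = 1\<^sub>m m"
    by (rule mat_eq_if_mult_vec_eq[of _ m m])
      (use M N h h' in \<open>auto simp: assoc_mult_mat_vec[of _ m m] simp flip: M(2) N(2)\<close>)
  moreover have "M * N = 1\<^sub>m m"
    by (rule mat_eq_if_mult_vec_eq[of _ m m])
      (use M N h h' in \<open>auto simp: assoc_mult_mat_vec[of _ m m] simp flip: M(2) N(2)\<close>)
  ultimately have "M \<in> carrier (GL2 m)"
    using M N by (auto simp: carrier_GL2)
  then show ?thesis
    using fh M(2) by (intro bexI[of _ M]) auto
qed

lemma automorphism_is_act: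
  assumes f: "f \<in> carrier (hAut H G)"
  shows "\<exists>\<pi> M. \<pi> permutes {1..s} \<and> M \<in> carrier (GL2 m) \<and> f = act \<pi> M"
proof -
  obtain \<pi> where \<pi>: "\<pi> permutes {1..s}"
    "\<And>A. A \<subseteq> {1..s} \<Longrightarrow> f (c A (0\<^sub>v m)) = c (\<pi> ` A) (0\<^sub>v m)"
    using automorphism_cube[OF f] by blast
  obtain M where M: "M \<in> carrier (GL2 m)" "\<And>v. v \<in> carrier_vec m \<Longrightarrow> f (c {} v) = c {} (M *\<^sub>v v)"
    using automorphism_vec[OF f] by blast
  have Mc: "M \<in> carrier_mat m m"
    using M(1) by (simp add: carrier_GL2)
  have hom: "\<And>x y. x \<in> G \<Longrightarrow> y \<in> G \<Longrightarrow> f ` hmult H x y = hmult H (f x) (f y)"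
    and ext: "f \<in> extensional G"
    using f by (auto simp: hAut_def Bij_def)
  have "f = act \<pi> M"
  proof (rule extensionalityI[OF ext])
    show "act \<pi> M \<in> extensional G"
      by (simp add: act_def)
    fix x assume "x \<in> G"
    then obtain A v where A: "A \<subseteq> {1..s}" "v \<in> carrier_vec m" "x = c A v"
      by (rule c_cases)
    \<comment> \<open>Both sides are singletons: the left one contains \<open>f x\<close>, the right
      one the value of \<open>act\<close>.\<close>
    have "f ` hmult H (c A (0\<^sub>v m)) (c {} v) = hmult H (c (\<pi> ` A) (0\<^sub>v m)) (c {} (M *\<^sub>v v))"
      using hom[of "c A (0\<^sub>v m)" "c {} v"] A by (simp add: c_in \<pi> M)
    then have "f x = c (\<pi> ` A) (M *\<^sub>v v)"
      using A Mc permutes_image_subset[OF \<pi>(1) A(1)] by (simp add: mult_cube_vec)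
    then show "f x = act \<pi> M x"
      using A by (simp add: act_c)
  qed
  then show ?thesis
    using \<pi>(1) M(1) by blast
qed

text \<open>The isomorphism is built from pairs to automorphisms, where \<open>act\<close> is
  explicit, and then reversed; \<open>iso_sym\<close> takes the group laws from the side of the
  pairs.\<close>

lemma hAut_iso: "hAut H G \<cong> sym_group s \<times>\<times> GL2 m"
proof -
  let ?K = "sym_group s \<times>\<times> GL2 m" and ?\<Psi> = "\<lambda>(\<pi>, M). act \<pi> M"
  have carrier: "(\<pi>, M) \<in> carrier ?K \<longleftrightarrow> \<pi> permutes {1..s} \<and> M \<in> carrier (GL2 m)" for \<pi> M
    by (simp add: sym_group_carrier)
  have mat: "M \<in> carrier_mat m m" if "M \<in> carrier (GL2 m)" for M
    using that by (simp add: carrier_GL2)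
  have "?\<Psi> \<in> iso ?K (hAut H G)"
  proof (rule isoI)
    show "?\<Psi> \<in> hom ?K (hAut H G)"
    proof (rule homI)
      fix x assume "x \<in> carrier ?K"
      then show "?\<Psi> x \<in> carrier (hAut H G)"
        by (cases x) (simp add: carrier act_automorphism del: carrier_DirProd)
    next
      fix x y assume xy: "x \<in> carrier ?K" "y \<in> carrier ?K"
      obtain \<pi> M \<pi>' M' where eq: "x = (\<pi>, M)" "y = (\<pi>', M')"
        by (metis surj_pair)
      have *: "\<pi> permutes {1..s}" "M \<in> carrier (GL2 m)" "\<pi>' permutes {1..s}" "M' \<in> carrier (GL2 m)"
        using xy unfolding eq carrier by auto
      have "act (\<pi> \<circ> \<pi>') (M * M') = compose G (act \<pi> M) (act \<pi>' M')"
      proof (rule extensionalityI[of _ G])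
        fix x assume "x \<in> G"
        then show "act (\<pi> \<circ> \<pi>') (M * M') x = compose G (act \<pi> M) (act \<pi>' M') x"
          using * mat by (simp add: compose_eq act_act)
      qed (simp_all add: act_def compose_def)
      then show "?\<Psi> (x \<otimes>\<^bsub>?K\<^esub> y) = ?\<Psi> x \<otimes>\<^bsub>hAut H G\<^esub> ?\<Psi> y"
        using * by (simp add: eq sym_group_mult mult_GL2 hAut_def BijGroup_def act_Bij)
    qed
    show "bij_betw ?\<Psi> (carrier ?K) (carrier (hAut H G))"
    proof (rule bij_betw_imageI)
      show "inj_on ?\<Psi> (carrier ?K)"
      proof (rule inj_onI)
        fix x y assume xy: "x \<in> carrier ?K" "y \<in> carrier ?K" "?\<Psi> x = ?\<Psi> y"
        obtain \<pi> M \<pi>' M' where eq: "x = (\<pi>, M)" "y = (\<pi>', M')"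
          by (metis surj_pair)
        show "x = y"
          using xy act_eq_imp_eq[of \<pi> \<pi>' M M'] mat unfolding eq carrier by simp
      qed
      show "?\<Psi> ` carrier ?K = carrier (hAut H G)"
      proof (intro equalityI subsetI)
        fix f assume "f \<in> ?\<Psi> ` carrier ?K"
        then show "f \<in> carrier (hAut H G)"
          using act_automorphism carrier by auto
      next
        fix f assume "f \<in> carrier (hAut H G)"
        then obtain \<pi> M where "\<pi> permutes {1..s}" "M \<in> carrier (GL2 m)" "f = act \<pi> M"
          using automorphism_is_act by blast
        then have "(\<pi>, M) \<in> carrier ?K" "f = ?\<Psi> (\<pi>, M)"
          using carrier by auto
        then show "f \<in> ?\<Psi> ` carrier ?K"
          by blast
      qed
    qed
  qed
  then have "?K \<cong> hAut H G"
    by (rule is_isoI)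
  then show ?thesis
    by (rule group.iso_sym[OF DirProd_group[OF sym_group_is_group group_GL2]])
qed

end

section \<open>The 2-rank in coordinates\<close>

text \<open>As the star fixes every element of \<open>G\<close>, being thin means having square {e},
  which ties thinness to the coordinates.\<close>

locale cube_vector_closed_subset = hypergroup H + cube_vector_coordinates H G s m c
  for H :: "('a, 'b) hyperstruct_scheme" and G s m c +
  assumes closed: "closed_subset H G" and star: "x \<in> G \<Longrightarrow> hstar H x = x"
begin

lemma G_subset_carrier: "G \<subseteq> carrier H"
  using closed by (simp add: closed_subset_def)

lemma thin_c_iff:
  assumes "A \<subseteq> {1..s}" "v \<in> carrier_vec m"
  shows "thin H (c A v) \<longleftrightarrow> A = {}"
proof
  assume "thin H (c A v)"
  then have "(\<lambda>C. c C (0\<^sub>v m)) ` Pow A = {c {} (0\<^sub>v m)}"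
    using assms c_in by (simp add: thin_def star mult_self one)
  then have "c A (0\<^sub>v m) = c {} (0\<^sub>v m)"
    by blast
  then show "A = {}"
    using assms by (simp add: c_eq_iff)
next
  assume "A = {}"
  then show "thin H (c A v)"
    using assms c_in[OF assms] G_subset_carrier by (auto simp: thin_def star mult_self one)
qed

lemma thin_in_G_cases:
  assumes "x \<in> G" "thin H x"
  obtains v where "v \<in> carrier_vec m" "x = c {} v"
  using assms c_cases thin_c_iff by metis

text \<open>The witness for the maximum in \<open>r2\<close>: by \<open>thin_c_iff\<close> these are
  all the thin elements of \<open>G\<close>.\<close>

lemma thin_closed_subset_vec: "thin_closed_subset H (c {} ` carrier_vec m)"
proof -
  have "hstar H ` c {} ` carrier_vec m = c {} ` carrier_vec m"
    unfolding image_image by (rule image_cong) (auto simp: star c_in)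
  then have "hset_mult H (hstar H ` c {} ` carrier_vec m) (c {} ` carrier_vec m) \<subseteq> c {} ` carrier_vec m"
    by (auto simp: hset_mult_def mult_vec)
  moreover have "c {} ` carrier_vec m \<subseteq> carrier H"
    using c_in G_subset_carrier by blast
  moreover have "c {} ` carrier_vec m \<noteq> {}"
    using zero_carrier_vec by blast
  ultimately show ?thesis
    by (simp add: thin_closed_subset_def closed_subset_def thin_c_iff)
qed

lemma thin_group_comm_group:
  assumes F: "thin_closed_subset H F" "F \<subseteq> G"
  shows "comm_group (thin_group H F)"
    and "x \<in> carrier (thin_group H F) \<Longrightarrow> x \<otimes>\<^bsub>thin_group H F\<^esub> x = \<one>\<^bsub>thin_group H F\<^esub>"
proof -
  let ?K = "thin_group H F"
  have closedF: "closed_subset H F"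
    using F by (simp add: thin_closed_subset_def)
  have elem: "\<exists>v\<in>carrier_vec m. a = c {} v" if "a \<in> F" for a
    using that F thin_in_G_cases[of a] by (auto simp: thin_closed_subset_def)
  have mult_F: "\<exists>d\<in>F. hmult H a b = {d}" if ab: "a \<in> F" "b \<in> F" for a b
  proof -
    obtain v w where *: "v \<in> carrier_vec m" "a = c {} v" "w \<in> carrier_vec m" "b = c {} w"
      using elem ab by metis
    have "hstar H a = a"
      using ab F by (auto intro: star)
    then have "hmult H a b \<subseteq> hset_mult H (hstar H ` F) F"
      using ab by (force simp: hset_mult_def)
    then show ?thesis
      using closedF * by (auto simp: closed_subset_def mult_vec)
  qed
  have self: "hmult H a a = {hone H}" if "a \<in> F" for a
    using elem[OF that] by (auto simp: mult_vec bit_vec_add_self one)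
  have carrier: "carrier ?K = (\<lambda>a. {a}) ` F" and mult_K: "x \<otimes>\<^bsub>?K\<^esub> y = hset_mult H x y"
    and one_K: "\<one>\<^bsub>?K\<^esub> = {hone H}" for x y
    by (simp_all add: thin_group_def)
  have F_carrier: "{a} \<subseteq> carrier H" if "a \<in> F" for a
    using that F G_subset_carrier by auto
  show "comm_group ?K"
  proof (rule comm_groupI)
    fix x y assume "x \<in> carrier ?K" "y \<in> carrier ?K"
    then obtain a b where ab: "a \<in> F" "x = {a}" "b \<in> F" "y = {b}"
      by (auto simp: carrier)
    then show "x \<otimes>\<^bsub>?K\<^esub> y \<in> carrier ?K"
      using mult_F[of a b] by (auto simp: carrier mult_K)
    obtain v w where "v \<in> carrier_vec m" "a = c {} v" "w \<in> carrier_vec m" "b = c {} w"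
      using elem ab by metis
    then show "x \<otimes>\<^bsub>?K\<^esub> y = y \<otimes>\<^bsub>?K\<^esub> x"
      using ab by (simp add: mult_K mult_vec comm_add_vec[of v m w])
  next
    fix x y z assume "x \<in> carrier ?K" "y \<in> carrier ?K" "z \<in> carrier ?K"
    then show "x \<otimes>\<^bsub>?K\<^esub> y \<otimes>\<^bsub>?K\<^esub> z = x \<otimes>\<^bsub>?K\<^esub> (y \<otimes>\<^bsub>?K\<^esub> z)"
      unfolding mult_K by (intro hset_mult_assoc) (use F_carrier carrier in auto)
  next
    show "\<one>\<^bsub>?K\<^esub> \<in> carrier ?K"
      using closed_subset_hone[OF closedF] by (auto simp: carrier one_K)
  next
    fix x assume x: "x \<in> carrier ?K"
    then show "\<one>\<^bsub>?K\<^esub> \<otimes>\<^bsub>?K\<^esub> x = x"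
      using F_carrier by (auto simp: carrier mult_K one_K)
    show "\<exists>y\<in>carrier ?K. y \<otimes>\<^bsub>?K\<^esub> x = \<one>\<^bsub>?K\<^esub>"
      by (rule bexI[OF _ x]) (use x self in \<open>auto simp: carrier mult_K one_K\<close>)
  qed
  show "x \<otimes>\<^bsub>?K\<^esub> x = \<one>\<^bsub>?K\<^esub>" if "x \<in> carrier ?K"
    using that self by (auto simp: carrier mult_K one_K)
qed

text \<open>Thin elements of \<open>G\<close> multiply as vectors, so the group is abelian of
  exponent 2 and passes this on to all subgroups. The rank becomes a matter of counting
  elements.\<close>

lemma elementary_abelian_2_subgroup_iff:
  assumes "thin_closed_subset H F" "F \<subseteq> G"
  shows "elementary_abelian_2_subgroup (thin_group H F) E \<longleftrightarrow> subgroup E (thin_group H F)"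
proof -
  interpret K: comm_group "thin_group H F"
    by (rule thin_group_comm_group[OF assms])
  have "comm_group (thin_group H F\<lparr>carrier := E\<rparr>)" if E: "subgroup E (thin_group H F)"
    by (rule group.group_comm_groupI[OF subgroup.subgroup_is_group[OF E K.is_group]])
      (use subgroup.subset[OF E] K.m_comm in auto)
  then show ?thesis
    unfolding elementary_abelian_2_subgroup_def
    using thin_group_comm_group(2)[OF assms] subgroup.mem_carrier[of E "thin_group H F"] by blast
qed

text \<open>A \<open>Max\<close> is informative over finite nonempty sets. The bound is |E| \<le>
  |F| \<le> 2^m, as \<open>F\<close> consists of vectors; the trivial subgroup has order
  2^0.\<close>

lemma two_rank_set:
  assumes F: "thin_closed_subset H F" "F \<subseteq> G"
  defines "R \<equiv> {n. \<exists>E. elementary_abelian_2_subgroup (thin_group H F) E \<and> card E = 2 ^ n}"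
  shows "R \<subseteq> {..m}" "0 \<in> R"
proof -
  interpret K: comm_group "thin_group H F"
    by (rule thin_group_comm_group[OF F])
  have sub: "F \<subseteq> c {} ` carrier_vec m"
  proof
    fix x assume "x \<in> F"
    then have "x \<in> G" "thin H x"
      using F by (auto simp: thin_closed_subset_def)
    then show "x \<in> c {} ` carrier_vec m"
      by (rule thin_in_G_cases) simp
  qed
  have fin: "finite F"
    using finite_subset[OF sub] finite_carrier_bit_vec by blast
  have card_F: "card F \<le> 2 ^ m"
    using card_mono[OF _ sub] card_image_le[OF finite_carrier_bit_vec, of "c {}" m]
      finite_carrier_bit_vec card_carrier_bit_vec by (metis finite_imageI le_trans)
  have carrier: "carrier (thin_group H F) = (\<lambda>a. {a}) ` F"
    by (simp add: thin_group_def)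
  show "R \<subseteq> {..m}"
  proof
    fix n assume "n \<in> R"
    then obtain E where "elementary_abelian_2_subgroup (thin_group H F) E" "card E = 2 ^ n"
      unfolding R_def by blast
    then have E: "E \<subseteq> (\<lambda>a. {a}) ` F" "card E = 2 ^ n"
      using subgroup.subset[of E "thin_group H F"] carrier
      by (simp_all add: elementary_abelian_2_subgroup_def)
    have "2 ^ n \<le> card ((\<lambda>a. {a}) ` F)"
      using card_mono[OF finite_imageI[OF fin] E(1)] E(2) by simp
    also have "\<dots> \<le> card F"
      by (rule card_image_le[OF fin])
    finally have "(2 :: nat) ^ n \<le> 2 ^ m"
      using card_F by (rule order_trans)
    then show "n \<in> {..m}"
      by simp
  qed
  show "0 \<in> R"
    unfolding R_def elementary_abelian_2_subgroup_iff[OF F]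
    by (intro CollectI exI[of _ "{\<one>\<^bsub>thin_group H F\<^esub>}"]) (simp add: K.triv_subgroup)
qed

lemma two_rank_le:
  assumes "thin_closed_subset H F" "F \<subseteq> G"
  shows "two_rank (thin_group H F) \<le> m"
proof -
  let ?R = "{n. \<exists>E. elementary_abelian_2_subgroup (thin_group H F) E \<and> card E = 2 ^ n}"
  have "finite ?R"
    using finite_subset[OF two_rank_set(1)[OF assms]] by simp
  moreover have "?R \<noteq> {}"
    using two_rank_set(2)[OF assms] by (metis empty_iff)
  ultimately have "Max ?R \<in> ?R"
    by (rule Max_in)
  then show ?thesis
    using two_rank_set(1)[OF assms] unfolding two_rank_def by (meson atMost_iff subsetD)
qed

lemma two_rank_vec: "two_rank (thin_group H (c {} ` carrier_vec m)) = m"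
proof -
  let ?F = "c {} ` carrier_vec m"
  have F: "thin_closed_subset H ?F" "?F \<subseteq> G"
    using thin_closed_subset_vec c_in by auto
  interpret K: comm_group "thin_group H ?F"
    by (rule thin_group_comm_group[OF F])
  have "card ?F = 2 ^ m"
    using card_image[of "c {}" "carrier_vec m"] card_carrier_bit_vec by (simp add: inj_on_def c_eq_iff)
  then have "card (carrier (thin_group H ?F)) = 2 ^ m"
    by (simp add: thin_group_def card_image)
  then have "m \<in> {n. \<exists>E. elementary_abelian_2_subgroup (thin_group H ?F) E \<and> card E = 2 ^ n}"
    using K.subgroup_self elementary_abelian_2_subgroup_iff[OF F] by blast
  moreover have "finite {n. \<exists>E. elementary_abelian_2_subgroup (thin_group H ?F) E \<and> card E = 2 ^ n}"
    using finite_subset[OF two_rank_set(1)[OF F]] by simp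
  ultimately have "m \<le> two_rank (thin_group H ?F)"
    unfolding two_rank_def by (intro Max_ge)
  then show ?thesis
    using two_rank_le[OF F] by simp
qed

lemma r2_eq: "r2 H G = m"
proof -
  have "finite (Pow {1..s} \<times> (carrier_vec m :: bit vec set))"
    using finite_carrier_bit_vec by simp
  then have "finite G"
    using bij_betw_finite[OF bij] by simp
  then have fin: "finite {F. thin_closed_subset H F \<and> F \<subseteq> G}"
    by (auto intro: finite_subset[of _ "Pow G"])
  show ?thesis
    unfolding r2_def
  proof (rule Max_eqI)
    show "finite {two_rank (thin_group H F) |F. thin_closed_subset H F \<and> F \<subseteq> G}"
      using finite_imageI[OF fin, of "\<lambda>F. two_rank (thin_group H F)"]
      by (simp add: setcompr_eq_image)
    show "n \<le> m" if "n \<in> {two_rank (thin_group H F) |F. thin_closed_subset H F \<and> F \<subseteq> G}" for n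
      using that two_rank_le by blast
    show "m \<in> {two_rank (thin_group H F) |F. thin_closed_subset H F \<and> F \<subseteq> G}"
      using two_rank_vec thin_closed_subset_vec c_in
      by (intro CollectI exI[of _ "c {} ` carrier_vec m"]) auto
  qed
qed

end

section \<open>Coordinates of a closed subset\<close>

context elementary_abelian_2
begin

lemma thick_idx_subset: "thick_idx \<subseteq> {1..p}"
  by (auto simp: thick_idx_def)

text \<open>In terms of index sets, a closed subset is the family of all \<open>A \<union> B\<close> where \<open>A \<subseteq> S\<close> for a
  fixed set \<open>S\<close> of thick indices and \<open>B\<close> lies in an \<open>\<FF>\<^sub>2\<close>-space \<open>V\<close> of sets of thin indices.\<close>

lemma closed_subset_coordinates:
  assumes G: "closed_subset H G"
  shows "\<exists>m c. cube_vector_closed_subset H G (s_set H q p G) m c"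
proof -
  define \<G> where "\<G> = {X. X \<subseteq> {1..p} \<and> elt X \<in> G}"
  have GH: "G \<subseteq> carrier H"
    using G by (simp add: closed_subset_def)
  have G_eq: "G = elt ` \<G>"
    using carrier_subset_elt GH by (auto simp: \<G>_def)
  have \<G>_sub: "X \<subseteq> {1..p}" if "X \<in> \<G>" for X
    using that by (simp add: \<G>_def)
  have star: "hstar H x = x" if "x \<in> G" for x
    using that hstar_elt \<G>_sub unfolding G_eq by blast
  \<comment> \<open>Since the star is trivial on \<open>G\<close>, the closure condition becomes
    closure under multiplication, expressed here by index sets.\<close>
  have \<G>_closed: "Z \<in> \<G>"
    if XY: "X \<in> \<G>" "Y \<in> \<G>"
      and Z: "sym_diff X Y \<subseteq> Z" "Z \<subseteq> sym_diff X Y \<union> (X \<inter> Y \<inter> thick_idx)" for X Y Z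
  proof -
    have c: "X \<subseteq> {1..p}" "Y \<subseteq> {1..p}" "elt X \<in> G" "elt Y \<in> G"
      using XY by (auto simp: \<G>_def)
    have "elt Z \<in> hmult H (elt X) (elt Y)"
      unfolding hmult_elt[OF c(1,2)] using Z by blast
    also have "\<dots> \<subseteq> hset_mult H (hstar H ` G) G"
      using c(3,4) star[OF c(3)] by (force simp: hset_mult_def)
    also have "\<dots> \<subseteq> G"
      using G by (simp add: closed_subset_def)
    finally have "elt Z \<in> G" .
    moreover have "Z \<subseteq> {1..p}"
      using c(1,2) Z(2) by blast
    ultimately show ?thesis
      by (simp add: \<G>_def)
  qed
  have sd: "sym_diff X Y \<in> \<G>" if "X \<in> \<G>" "Y \<in> \<G>" for X Y
    using \<G>_closed[OF that] by blast
  have thick_sub: "A \<in> \<G>" if "X \<in> \<G>" "A \<subseteq> X \<inter> thick_idx" for X A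
    using \<G>_closed[of X X A] that by blast
  have empty: "{} \<in> \<G>"
    using closed_subset_hone[OF G] by (simp add: \<G>_def elt_empty)
  \<comment> \<open>Defined by single indices, yet \<open>S\<close> contains the thick part of every
    member (\<open>thick_part\<close>), and all its subsets occur, itself included
    (\<open>S_mem\<close>).\<close>
  define S where "S = {i \<in> thick_idx. {i} \<in> \<G>}"
  define V where "V = {X \<in> \<G>. X \<inter> thick_idx = {}}"
  have S_sub: "S \<subseteq> thick_idx" and finS: "finite S"
    using finite_subset[of S "{1..p}"] thick_idx_subset by (auto simp: S_def)
  have S_mem: "A \<in> \<G>" if "A \<subseteq> S" for A
    using finite_subset[OF that finS] that
  proof (induction A rule: finite_induct)
    case empty
    show ?case
      by (rule \<open>{} \<in> \<G>\<close>)
  next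
    case (insert i A)
    then have "sym_diff {i} A \<in> \<G>"
      by (intro sd) (auto simp: S_def)
    moreover have "sym_diff {i} A = insert i A"
      using insert by auto
    ultimately show ?case
      by simp
  qed
  have thick_part: "X \<inter> thick_idx \<subseteq> S" if "X \<in> \<G>" for X
    using thick_sub[OF that] by (auto simp: S_def)
  have thin_part: "X - thick_idx \<in> V" if "X \<in> \<G>" for X
  proof -
    have "sym_diff X (X \<inter> thick_idx) \<in> \<G>"
      by (intro sd that thick_sub[OF that]) auto
    moreover have "sym_diff X (X \<inter> thick_idx) = X - thick_idx"
      by blast
    ultimately show ?thesis
      by (auto simp: V_def)
  qed
  have union: "A \<union> B \<in> \<G>" if "A \<subseteq> S" "B \<in> V" for A B
  proof -
    have "sym_diff A B \<in> \<G>"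
      using that S_mem by (intro sd) (auto simp: V_def)
    moreover have "sym_diff A B = A \<union> B"
      using that S_sub by (auto simp: V_def)
    ultimately show ?thesis
      by simp
  qed
  have s_eq: "s_set H q p G = card S"
  proof -
    have "s_elem H q p ` G = (\<lambda>X. card (X \<inter> thick_idx)) ` \<G>"
      unfolding G_eq image_image by (rule image_cong[OF refl]) (rule s_elem_elt[OF \<G>_sub])
    moreover have "Max ((\<lambda>X. card (X \<inter> thick_idx)) ` \<G>) = card S"
    proof (rule Max_eqI)
      have "finite \<G>"
        by (rule finite_subset[of _ "Pow {1..p}"]) (auto simp: \<G>_def)
      then show "finite ((\<lambda>X. card (X \<inter> thick_idx)) ` \<G>)"
        by simp
      show "n \<le> card S" if "n \<in> (\<lambda>X. card (X \<inter> thick_idx)) ` \<G>" for n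
        using that thick_part card_mono[OF finS] by blast
      \<comment> \<open>The maximum is attained at \<open>S\<close>, itself a member of
        \<open>\<G>\<close>.\<close>
      show "card S \<in> (\<lambda>X. card (X \<inter> thick_idx)) ` \<G>"
        using S_mem[of S] S_sub by (intro image_eqI[of _ _ S]) (auto simp: Int_absorb2)
    qed
    ultimately show ?thesis
      by (simp add: s_set_def)
  qed
  have "\<exists>m \<beta>. bij_betw \<beta> (carrier_vec m :: bit vec set) V \<and>
    (\<forall>v\<in>carrier_vec m. \<forall>w\<in>carrier_vec m. \<beta> (v + w) = sym_diff (\<beta> v) (\<beta> w))"
  proof (rule sym_diff_closed_coordinates)
    show "V \<subseteq> Pow {1..p}"
      by (auto simp: V_def \<G>_def)
    show "{} \<in> V"
      using empty by (simp add: V_def)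
    show "sym_diff X Y \<in> V" if "X \<in> V" "Y \<in> V" for X Y
      using that sd[of X Y] by (auto simp: V_def)
  qed simp
  then obtain m and \<beta> :: "bit vec \<Rightarrow> nat set" where \<beta>: "bij_betw \<beta> (carrier_vec m) V"
    and \<beta>_add: "\<And>v w. v \<in> carrier_vec m \<Longrightarrow> w \<in> carrier_vec m \<Longrightarrow> \<beta> (v + w) = sym_diff (\<beta> v) (\<beta> w)"
    by blast
  \<comment> \<open>\<open>sym_group\<close> permutes an initial segment starting at 1, so
    \<open>S\<close> is numbered accordingly.\<close>
  obtain \<sigma> where \<sigma>: "bij_betw \<sigma> {1..card S} S"
    using ex_bij_betw_nat_finite_1[OF finS] by blast
  have \<sigma>_inj: "inj_on \<sigma> {1..card S}"
    using \<sigma> by (rule bij_betw_imp_inj_on)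
  have \<sigma>_sub: "\<sigma> ` A \<subseteq> S" if "A \<subseteq> {1..card S}" for A
    using that \<sigma> by (auto simp: bij_betw_def)
  have \<beta>_in: "\<beta> v \<in> V" if "v \<in> carrier_vec m" for v
    using that \<beta> by (rule bij_betwE[rule_format, rotated])
  have \<beta>_thin: "\<beta> v \<inter> thick_idx = {}" if "v \<in> carrier_vec m" for v
    using \<beta>_in[OF that] by (simp add: V_def)
  define c where "c A v = elt (\<sigma> ` A \<union> \<beta> v)" for A v
  have in_\<G>: "\<sigma> ` A \<union> \<beta> v \<in> \<G>" if "A \<subseteq> {1..card S}" "v \<in> carrier_vec m" for A v
    using that \<sigma>_sub \<beta>_in by (intro union)
  have bij: "bij_betw (\<lambda>(A, v). c A v) (Pow {1..card S} \<times> carrier_vec m) G"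
  proof (rule bij_betw_imageI)
    show "inj_on (\<lambda>(A, v). c A v) (Pow {1..card S} \<times> carrier_vec m)"
    proof (rule inj_onI, clarify)
      fix A v B w
      assume A: "A \<subseteq> {1..card S}" "v \<in> carrier_vec m" and B: "B \<subseteq> {1..card S}" "w \<in> carrier_vec m"
        and eq: "c A v = c B w"
      have un: "\<sigma> ` A \<union> \<beta> v = \<sigma> ` B \<union> \<beta> w"
        using inj_onD[OF elt_inj eq[unfolded c_def]] \<G>_sub in_\<G>[OF A] in_\<G>[OF B] by blast
      \<comment> \<open>The parts coming from \<open>\<sigma>\<close> are thick and those from
        \<open>\<beta>\<close> thin, so the union determines both.\<close>
      have "\<sigma> ` A = \<sigma> ` B" "\<beta> v = \<beta> w"
        using un \<sigma>_sub[OF A(1)] \<sigma>_sub[OF B(1)] S_sub \<beta>_thin[OF A(2)] \<beta>_thin[OF B(2)] by blast+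
      then show "A = B \<and> v = w"
        using inj_on_image_eq_iff[OF \<sigma>_inj A(1) B(1)]
          inj_onD[OF bij_betw_imp_inj_on[OF \<beta>] _ A(2) B(2)] by simp
    qed
    show "(\<lambda>(A, v). c A v) ` (Pow {1..card S} \<times> carrier_vec m) = G"
    proof (intro equalityI subsetI)
      fix x assume "x \<in> (\<lambda>(A, v). c A v) ` (Pow {1..card S} \<times> carrier_vec m)"
      then show "x \<in> G"
        using in_\<G> by (auto simp: c_def G_eq)
    next
      fix x assume "x \<in> G"
      then obtain X where X: "X \<in> \<G>" "x = elt X"
        using G_eq by blast
      obtain A where A: "A \<subseteq> {1..card S}" "X \<inter> thick_idx = \<sigma> ` A"
        using thick_part[OF X(1)] bij_betw_imp_surj_on[OF \<sigma>] by (metis subset_imageE)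
      obtain v where v: "v \<in> carrier_vec m" "X - thick_idx = \<beta> v"
        using thin_part[OF X(1)] \<beta> by (auto simp: bij_betw_def)
      have "X = \<sigma> ` A \<union> \<beta> v"
        using A v by blast
      then have "x = c A v"
        using X by (simp add: c_def)
      then show "x \<in> (\<lambda>(A, v). c A v) ` (Pow {1..card S} \<times> carrier_vec m)"
        using A v by blast
    qed
  qed
  have mult: "hmult H (c A v) (c B w) = (\<lambda>C. c C (v + w)) ` {C. sym_diff A B \<subseteq> C \<and> C \<subseteq> A \<union> B}"
    if A: "A \<subseteq> {1..card S}" and B: "B \<subseteq> {1..card S}"
      and v: "v \<in> carrier_vec m" and w: "w \<in> carrier_vec m" for A B v w
  proof -
    let ?X = "\<sigma> ` A \<union> \<beta> v" and ?Y = "\<sigma> ` B \<union> \<beta> w"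
    have sets: "\<sigma> ` A \<subseteq> thick_idx" "\<sigma> ` B \<subseteq> thick_idx" "\<beta> v \<inter> thick_idx = {}" "\<beta> w \<inter> thick_idx = {}"
      using \<sigma>_sub[OF A] \<sigma>_sub[OF B] S_sub \<beta>_thin v w by auto
    have interval: "{Z. sym_diff ?X ?Y \<subseteq> Z \<and> Z \<subseteq> sym_diff ?X ?Y \<union> (?X \<inter> ?Y \<inter> thick_idx)} =
        (\<lambda>C. C \<union> \<beta> (v + w)) ` {C. sym_diff (\<sigma> ` A) (\<sigma> ` B) \<subseteq> C \<and> C \<subseteq> \<sigma> ` A \<union> \<sigma> ` B}"
      (is "?L = _")
      unfolding \<beta>_add[OF v w] by (rule interval_disjoint_union[OF sets])
    have "hmult H (c A v) (c B w) = elt ` ?L"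
      unfolding c_def using \<G>_sub in_\<G>[OF A v] in_\<G>[OF B w] by (intro hmult_elt)
    also have "\<dots> = elt ` (\<lambda>C. C \<union> \<beta> (v + w)) ` ((`) \<sigma> ` {C. sym_diff A B \<subseteq> C \<and> C \<subseteq> A \<union> B})"
      unfolding interval image_sym_diff_interval[OF \<sigma>_inj A B] ..
    finally show ?thesis
      by (simp add: image_image c_def)
  qed
  have one: "c {} (0\<^sub>v m) = hone H"
  proof -
    \<comment> \<open>Zero is the sum of zero with itself, and a set has empty symmetric difference
      with itself.\<close>
    have "\<beta> (0\<^sub>v m) = {}"
      using \<beta>_add[of "0\<^sub>v m" "0\<^sub>v m"] by simp
    then show ?thesis
      by (simp add: c_def elt_empty)
  qed
  have "cube_vector_closed_subset H G (card S) m c"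
    by unfold_locales (use bij mult one G star in auto)
  then show ?thesis
    unfolding s_eq by blast
qed

lemma s_set_carrier: "s_set H q p (carrier H) = p_sharp H q p"
proof -
  have fin: "finite thick_idx"
    using finite_subset[OF thick_idx_subset] by simp
  have "carrier H = elt ` Pow {1..p}"
    using elt_bij by (simp add: bij_betw_def)
  then have "s_elem H q p ` carrier H = (\<lambda>X. card (X \<inter> thick_idx)) ` Pow {1..p}"
    by (simp add: image_image s_elem_elt)
  moreover have "Max ((\<lambda>X. card (X \<inter> thick_idx)) ` Pow {1..p}) = card thick_idx"
  proof (rule Max_eqI)
    show "n \<le> card thick_idx" if "n \<in> (\<lambda>X. card (X \<inter> thick_idx)) ` Pow {1..p}" for n
      using that by (auto intro!: card_mono fin)
    show "card thick_idx \<in> (\<lambda>X. card (X \<inter> thick_idx)) ` Pow {1..p}"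
      using thick_idx_subset by (intro image_eqI[of _ _ thick_idx]) auto
  qed simp
  ultimately show ?thesis
    by (simp add: s_set_def p_sharp_eq)
qed

lemma hAut_closed_subset:
  assumes "closed_subset H G"
  shows "hAut H G \<cong> sym_group (s_set H q p G) \<times>\<times> GL2 (r2 H G)"
proof -
  obtain m c where "cube_vector_closed_subset H G (s_set H q p G) m c"
    using closed_subset_coordinates[OF assms] by blast
  then interpret cube_vector_closed_subset H G "s_set H q p G" m c .
  show ?thesis
    using hAut_iso r2_eq by simp
qed

text \<open>Counting identifies the dimension: index sets give |H| = 2^p, the coordinates give 2 to
  the power \<open>p_sharp H q p\<close> times 2^m, and \<open>m\<close> is the 2-rank by
  \<open>r2_eq\<close>.\<close>

lemma r2_carrier: "r2 H (carrier H) = p - p_sharp H q p"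
proof -
  obtain m c where "cube_vector_closed_subset H (carrier H) (p_sharp H q p) m c"
    using closed_subset_coordinates[OF closed_subset_carrier] s_set_carrier by auto
  then interpret cube_vector_closed_subset H "carrier H" "p_sharp H q p" m c .
  have "card (carrier H) = 2 ^ p"
    using bij_betw_same_card[OF elt_bij] by (simp add: card_Pow)
  moreover have "card (carrier H) = 2 ^ p_sharp H q p * 2 ^ m"
    using bij_betw_same_card[OF bij] by (simp add: card_cartesian_product card_Pow card_carrier_bit_vec)
  ultimately have "(2 :: nat) ^ p = 2 ^ (p_sharp H q p + m)"
    by (simp add: power_add)
  then have "p = p_sharp H q p + m"
    by simp
  then show ?thesis
    using r2_eq by simp
qed

end

theorem theorem4p21:
  fixes H :: "('a, 'b) hyperstruct_scheme" and q :: "nat \<Rightarrow> 'a" and p :: nat and G :: "'a set"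
  assumes "elementary_abelian_2_hypergroup H q p"
    and "closed_subset H G"
  shows "hAut H G \<cong> sym_group (s_set H q p G) \<times>\<times> GL2 (r2 H G) \<and>
    hAut H (carrier H) \<cong> sym_group (p_sharp H q p) \<times>\<times> GL2 (p - p_sharp H q p)"
proof -
  interpret hypergroup H
    using assms(1) by (simp add: elementary_abelian_2_hypergroup_def)
  interpret elementary_abelian_2 H q p
    using assms(1) by unfold_locales (simp_all add: elementary_abelian_2_hypergroup_def)
  show ?thesis
    using hAut_closed_subset[OF assms(2)] hAut_closed_subset[OF closed_subset_carrier]
    by (simp add: s_set_carrier r2_carrier)
qed

end
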